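(* Let $G$ be a finite simple graph. Then $G$ has a $\{P_2, C_3, P_5, \mathcal{T}(3)\}$-factor if and only if \[ \mathit{iso}(G-S) \le \tfrac{3}{2}|S| \quad \text{for all } S \subseteq V(G). \]
   Context: For a graph $H$, $\mathit{iso}(H)$ denotes the number of isolated vertices of $H$. $P_n$ and $C_n$ denote the path and the cycle on $n$ vertices. For a set $\mathcal{S}$ of connected graphs, an $\mathcal{S}$-factor of $G$ is a spanning subgraph $F$ of $G$ every component of which is isomorphic to an element of $\mathcal{S}$. The family $\mathcal{T}(3)$ of trees is defined as follows: a $\{1,3\}$-tree is a tree in which every vertex has degree $1$ or $3$. For any $\{1,3\}$-tree $R$, let $T_R$ be the tree obtained from $R$ by inserting a new vertex of degree $2$ into every edge of $R$ (subdividing each edge once), and then attaching to every leaf of $R$ one new pendant edge together with its new endpoint. $\mathcal{T}(3)$ is the set of all trees $T_R$ obtained in this way from all $\{1,3\}$-trees $R$. *)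

theory Defs
  imports Complex_Main
begin

record 'a ugraph =
  verts :: "'a set"
  edges :: "'a set set"

definition finite_simple_graph :: "'a ugraph \<Rightarrow> bool" where
  "finite_simple_graph G \<longleftrightarrow>
     finite (verts G) \<and> (\<forall>e\<in>edges G. e \<subseteq> verts G \<and> card e = 2)"

definition degree :: "'a ugraph \<Rightarrow> 'a \<Rightarrow> nat" where
  "degree G v = card {e \<in> edges G. v \<in> e}"

definition leaves :: "'a ugraph \<Rightarrow> 'a set" where
  "leaves G = {v \<in> verts G. degree G v = 1}"

definition iso_number :: "'a ugraph \<Rightarrow> nat" where
  "iso_number G = card {v \<in> verts G. degree G v = 0}"

definition del_verts :: "'a ugraph \<Rightarrow> 'a set \<Rightarrow> 'a ugraph" where
  "del_verts G S = \<lparr>verts = verts G - S, edges = {e \<in> edges G. e \<inter> S = {}}\<rparr>"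

definition induced :: "'a ugraph \<Rightarrow> 'a set \<Rightarrow> 'a ugraph" where
  "induced G U = \<lparr>verts = verts G \<inter> U, edges = {e \<in> edges G. e \<subseteq> U}\<rparr>"

definition subgraph :: "'a ugraph \<Rightarrow> 'a ugraph \<Rightarrow> bool" where
  "subgraph H G \<longleftrightarrow>
     finite_simple_graph H \<and> verts H \<subseteq> verts G \<and> edges H \<subseteq> edges G"

definition spanning_subgraph :: "'a ugraph \<Rightarrow> 'a ugraph \<Rightarrow> bool" where
  "spanning_subgraph F G \<longleftrightarrow> subgraph F G \<and> verts F = verts G"

definition isomorphic :: "'a ugraph \<Rightarrow> 'b ugraph \<Rightarrow> bool" where
  "isomorphic G H \<longleftrightarrow>
     (\<exists>f. bij_betw f (verts G) (verts H) \<and> edges H = (\<lambda>e. f ` e) ` edges G)"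

definition reachable :: "'a ugraph \<Rightarrow> 'a \<Rightarrow> 'a \<Rightarrow> bool" where
  "reachable G u v \<longleftrightarrow> (u, v) \<in> {(x, y). {x, y} \<in> edges G}\<^sup>*"

definition connected_graph :: "'a ugraph \<Rightarrow> bool" where
  "connected_graph G \<longleftrightarrow>
     verts G \<noteq> {} \<and> (\<forall>u\<in>verts G. \<forall>v\<in>verts G. reachable G u v)"

definition components :: "'a ugraph \<Rightarrow> 'a ugraph set" where
  "components G = {induced G {u \<in> verts G. reachable G v u} | v. v \<in> verts G}"

definition path_graph :: "nat \<Rightarrow> nat ugraph" where
  "path_graph n = \<lparr>verts = {..<n}, edges = {{i, Suc i} | i. Suc i < n}\<rparr>"

text \<open>Meaningful for n at least 3 only.\<close>

definition cycle_graph :: "nat \<Rightarrow> nat ugraph" where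
  "cycle_graph n = \<lparr>verts = {..<n}, edges = {{i, Suc i mod n} | i. i < n}\<rparr>"

definition tree :: "'a ugraph \<Rightarrow> bool" where
  "tree G \<longleftrightarrow> finite_simple_graph G \<and> connected_graph G \<and>
     \<not> (\<exists>n\<ge>3. \<exists>H. subgraph H G \<and> isomorphic H (cycle_graph n))"

definition one_three_tree :: "'a ugraph \<Rightarrow> bool" where
  "one_three_tree R \<longleftrightarrow> tree R \<and> (\<forall>v\<in>verts R. degree R v \<in> {1, 3})"

text \<open>In the tree obtained from R, the vertex \<open>Mid e\<close> subdivides the edge e of R, and
  \<open>Pend v\<close> is the end of the pendant edge attached to the leaf v of R.\<close>

datatype 'a tvertex = Orig 'a | Mid "'a set" | Pend 'a

definition T_of :: "'a ugraph \<Rightarrow> 'a tvertex ugraph" where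
  "T_of R = \<lparr>verts = Orig ` verts R \<union> Mid ` edges R \<union> Pend ` leaves R,
     edges = {{Orig v, Mid e} | v e. e \<in> edges R \<and> v \<in> e}
           \<union> {{Orig v, Pend v} | v. v \<in> leaves R}\<rparr>"

text \<open>Graphs matter here only up to isomorphism, so both the {1,3}-trees R and the members of
  the family are taken with natural numbers as vertices; every finite graph has such a copy.\<close>

definition T3 :: "nat ugraph set" where
  "T3 = {H. finite_simple_graph H \<and>
            (\<exists>R :: nat ugraph. one_three_tree R \<and> isomorphic H (T_of R))}"

definition is_factor :: "'b ugraph set \<Rightarrow> 'a ugraph \<Rightarrow> 'a ugraph \<Rightarrow> bool" where
  "is_factor \<S> F G \<longleftrightarrow>
     spanning_subgraph F G \<and> (\<forall>C\<in>components F. \<exists>H\<in>\<S>. isomorphic C H)"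

end

theory Submission
  imports Defs
begin

text \<open>
  Both sides are equivalent to the existence of a symmetric weighting of the edges by natural numbers
  with every vertex sum in {2, 3}. In \<open>T\<^sub>R\<close> give the pendant edges weight 2 and all others weight 1; the
  other members of the family are easy, and the weighting of a factor gives the bound on isolated
  vertices by double counting.

  Conversely the bound gives \<open>2|X| \<le> 3|N(X)|\<close> for all vertex sets, so augmenting paths in the
  bipartite double cover produce a possibly asymmetric weighting \<open>w\<close> with all row and column
  sums in {2, 3}. The sums of \<open>w + w\<^sup>T\<close> lie in {4, 5, 6}; pushing a defect along edges of odd weight
  makes all its weights even, and halving gives a symmetric weighting. One that minimises the
  total weight plus twice the number of edges used has a support whose components are \<open>P\<^sub>2\<close>, \<open>C\<^sub>3\<close>,
  or \<open>T\<^sub>R\<close>, where the vertices of \<open>R\<close> are those of weight 3: any other local structure and any cycle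
  of \<open>R\<close> would allow a cheaper weighting.
\<close>

section \<open>Weightings from vertex expansion\<close>

text \<open>The factor 3/2 enters as the ratio between the largest and the smallest vertex sum
  allowed. Symmetry is the obstacle to an integral weighting: averaging a weighting of the double
  cover with its transpose yields half-integers, and for exactly prescribed sums these can get stuck
  on odd cycles, as in a triangle with all sums 1. Here each vertex may choose between 2 and 3, and
  this slack absorbs every parity defect. Nothing yet makes the support of a weighting resemble a
  factor; that is the role of the cost, whose term for edges rewards concentrating the weight. A
  cheapest weighting is tested against a handful of explicit exchanges, each of which rules out one
  pattern in the support.\<close>

definition symupd :: "('a \<Rightarrow> 'a \<Rightarrow> nat) \<Rightarrow> 'a \<Rightarrow> 'a \<Rightarrow> nat \<Rightarrow> 'a \<Rightarrow> 'a \<Rightarrow> nat" where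
  "symupd f x y k = (\<lambda>u v. if u = x \<and> v = y \<or> u = y \<and> v = x then k else f u v)"

locale adjacency =
  fixes V :: "'a set" and adj :: "'a \<Rightarrow> 'a \<Rightarrow> bool"
  assumes finite_V: "finite V"
    and adj_sym: "adj x y \<Longrightarrow> adj y x"
    and adj_irrefl: "\<not> adj x x"
    and adj_in: "adj x y \<Longrightarrow> x \<in> V"
begin

lemma adj_in2: "adj x y \<Longrightarrow> y \<in> V"
  using adj_in adj_sym by blast

text \<open>An arbitrary \<open>w\<close> is a weighting of the bipartite double cover, with
  \<open>w x y\<close> on the edge from the left copy of \<open>x\<close> to the right copy of
  \<open>y\<close>; \<open>row\<close> and \<open>col\<close> are the vertex sums on the two sides.
  For a symmetric \<open>w\<close> they agree.\<close>

definition row :: "('a \<Rightarrow> 'a \<Rightarrow> nat) \<Rightarrow> 'a \<Rightarrow> nat" where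
  "row w x = (\<Sum>y\<in>V. w x y)"

definition col :: "('a \<Rightarrow> 'a \<Rightarrow> nat) \<Rightarrow> 'a \<Rightarrow> nat" where
  "col w y = (\<Sum>x\<in>V. w x y)"

definition supported :: "('a \<Rightarrow> 'a \<Rightarrow> nat) \<Rightarrow> bool" where
  "supported w \<longleftrightarrow> (\<forall>x y. w x y > 0 \<longrightarrow> adj x y)"

definition symmetric :: "('a \<Rightarrow> 'a \<Rightarrow> nat) \<Rightarrow> bool" where
  "symmetric w \<longleftrightarrow> (\<forall>x y. w x y = w y x)"

definition weighting :: "('a \<Rightarrow> 'a \<Rightarrow> nat) \<Rightarrow> bool" where
  "weighting f \<longleftrightarrow> symmetric f \<and> supported f \<and> (\<forall>x\<in>V. row f x \<in> {2, 3})"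

lemma sum_fun_upd:
  assumes "b \<in> V"
  shows "(\<Sum>y\<in>V. (g(b := k)) y) = (\<Sum>y\<in>V. g y) - g b + (k::nat)"
proof -
  have "(\<Sum>y\<in>V. (g(b := k)) y) = k + (\<Sum>y\<in>V - {b}. (g(b := k)) y)"
    using assms finite_V by (subst sum.remove[of V b]) auto
  also have "(\<Sum>y\<in>V - {b}. (g(b := k)) y) = (\<Sum>y\<in>V - {b}. g y)"
    by (rule sum.cong) auto
  also have "(\<Sum>y\<in>V. g y) = g b + (\<Sum>y\<in>V - {b}. g y)"
    using assms finite_V by (subst sum.remove[of V b]) auto
  ultimately show ?thesis by simp
qed

lemma row_ge: "y \<in> V \<Longrightarrow> w x y \<le> row w x"
  unfolding row_def using finite_V by (simp add: member_le_sum)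

lemma row_symupd:
  assumes "x \<in> V" "y \<in> V" "x \<noteq> y" "symmetric f"
  shows "row (symupd f x y k) u = (if u = x \<or> u = y then row f u - f x y + k else row f u)"
proof -
  have "symupd f x y k u = (if u = x then (f x)(y := k) else if u = y then (f y)(x := k) else f u)"
    using assms(3) by (auto simp: symupd_def)
  moreover have "f y x = f x y" using assms(4) by (simp add: symmetric_def)
  ultimately show ?thesis
    using assms by (auto simp: row_def sum_fun_upd simp del: fun_upd_apply)
qed

lemma symmetric_symupd: "symmetric f \<Longrightarrow> symmetric (symupd f x y k)"
  by (auto simp: symmetric_def symupd_def)

lemma supported_symupd: "supported f \<Longrightarrow> adj x y \<Longrightarrow> supported (symupd f x y k)"
  using adj_sym by (auto simp: supported_def symupd_def)

section \<open>Augmenting paths in the bipartite double cover\<close>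

definition deficiency :: "('a \<Rightarrow> 'a \<Rightarrow> nat) \<Rightarrow> nat" where
  "deficiency w = (\<Sum>x\<in>V. (2 - row w x) + (2 - col w x))"

text \<open>Only the upper bounds are imposed. The lower bounds are left to
  \<open>deficiency\<close>, where truncated subtraction makes a sum of 2 or 3 contribute
  nothing.\<close>

definition bounded_flow :: "('a \<Rightarrow> 'a \<Rightarrow> nat) \<Rightarrow> bool" where
  "bounded_flow w \<longleftrightarrow> supported w \<and> (\<forall>x\<in>V. row w x \<le> 3 \<and> col w x \<le> 3)"

text \<open>Two edges of an alternating path, seen from the left side only: at the right vertex
  \<open>y\<close>, one unit can be taken from \<open>z\<close> and given to \<open>x\<close>
  without changing the column sum of \<open>y\<close>.\<close>

definition exchange :: "('a \<Rightarrow> 'a \<Rightarrow> nat) \<Rightarrow> ('a \<times> 'a) set" where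
  "exchange w = {(x, z). \<exists>y. adj x y \<and> w z y > 0}"

lemma row_upd: "b \<in> V \<Longrightarrow>
    row (w(a := (w a)(b := k))) u = (if u = a then row w a - w a b + k else row w u)"
  using sum_fun_upd[of b "w a"] by (simp add: row_def)

lemma col_upd:
  assumes "a \<in> V"
  shows "col (w(a := (w a)(b := k))) u = (if u = b then col w b - w a b + k else col w u)"
proof (cases "u = b")
  case True
  have "col (w(a := (w a)(b := k))) b = (\<Sum>x\<in>V. ((\<lambda>x. w x b)(a := k)) x)"
    unfolding col_def by (rule sum.cong) auto
  then show ?thesis
    unfolding sum_fun_upd[OF assms] using True by (simp add: col_def)
next
  case False
  then show ?thesis unfolding col_def by (auto intro: sum.cong)
qed

text \<open>Shifting one unit at \<open>y\<close> from the last vertex of the path to its predecessor keeps the column sums and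
  makes the predecessor the new vertex of row sum 3, on a shorter path.\<close>

lemma augment_path:
  assumes "bounded_flow w" "row w u < 2" "u \<in> V" "p 0 = u"
    "\<And>i. i < n \<Longrightarrow> (p i, p (Suc i)) \<in> exchange w" "row w (p n) = 3"
  shows "\<exists>w'. bounded_flow w' \<and> deficiency w' < deficiency w"
  using assms
proof (induction n arbitrary: w rule: less_induct)
  case (less n)
  \<comment> \<open>Cutting the path at its first vertex of row sum 3 leaves the predecessor room
    for a unit, and ensures that the weights at the earlier vertices, on which the shorter path
    depends, are not lowered by the shift.\<close>
  define k where "k = (LEAST i. row w (p i) = 3)"
  have k: "row w (p k) = 3" unfolding k_def by (rule LeastI, rule less.prems(6))
  have kn: "k \<le> n" unfolding k_def by (rule Least_le, rule less.prems(6))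
  have before: "row w (p i) \<noteq> 3" if "i < k" for i using that not_less_Least unfolding k_def by blast
  have "k \<noteq> 0" using k less.prems(2,4) by (cases k) auto
  then obtain j where j: "k = Suc j" by (cases k) auto
  define x t where "x = p j" and "t = p k"
  have "(x, t) \<in> exchange w" using less.prems(5)[of j] kn j by (simp add: x_def t_def)
  then obtain y where y: "adj x y" "w t y > 0" by (auto simp: exchange_def)
  have bf: "supported w" "\<And>v. v \<in> V \<Longrightarrow> row w v \<le> 3 \<and> col w v \<le> 3"
    using less.prems(1) by (auto simp: bounded_flow_def)
  have ty: "adj t y" using y bf by (auto simp: supported_def)
  have inV: "x \<in> V" "y \<in> V" "t \<in> V" using y ty adj_in adj_in2 by auto
  have xr: "row w x \<le> 2" using before[of j] bf(2)[OF inV(1)] j by (auto simp: x_def)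
  have tr: "row w t = 3" using k by (simp add: t_def)
  have xt: "x \<noteq> t" using xr tr by auto
  define w1 where "w1 = w(x := (w x)(y := Suc (w x y)))"
  define w' where "w' = w1(t := (w1 t)(y := w t y - 1))"
  have w1t: "w1 t y = w t y" using xt by (simp add: w1_def)
  have g: "w x y \<le> row w x" "w t y \<le> row w t" using row_ge inV by auto
  have cg: "w x y \<le> col w y" "w t y \<le> col w y"
    unfolding col_def using inV finite_V by (auto intro: member_le_sum[of _ _ "\<lambda>z. w z y"])
  have r1: "row w1 v = (if v = x then row w x + 1 else row w v)" for v
    unfolding w1_def using row_upd[OF inV(2), of w x _ v] g by auto
  have c1: "col w1 v = (if v = y then col w y + 1 else col w v)" for v
    unfolding w1_def using col_upd[OF inV(1), of w y _ v] cg by auto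
  have r': "row w' v = (if v = t then 2 else if v = x then row w x + 1 else row w v)" for v
    unfolding w'_def using row_upd[OF inV(2), of w1 t _ v] g y tr r1 w1t xt by auto
  have c': "col w' v = col w v" for v
    unfolding w'_def using col_upd[OF inV(3), of w1 y _ v] cg y c1 w1t xt by auto
  have sup: "supported w'" using bf(1) y ty by (auto simp: supported_def w'_def w1_def)
  have bw': "bounded_flow w'" unfolding bounded_flow_def using sup r' c' bf(2) xr by auto
  have le: "(2 - row w' v) + (2 - col w' v) \<le> (2 - row w v) + (2 - col w v)" for v
    using r'[of v] c'[of v] tr by auto
  show ?case
  proof (cases "row w x < 2")
    case True
    have "deficiency w' < deficiency w" unfolding deficiency_def
    proof (rule sum_strict_mono_ex1[OF finite_V])
      show "\<exists>a\<in>V. 2 - row w' a + (2 - col w' a) < 2 - row w a + (2 - col w a)"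
        using True xt r'[of x] c'[of x] inV by (intro bexI[of _ x]) auto
    qed (use le in auto)
    then show ?thesis using bw' by blast
  next
    case False
    then have x2: "row w x = 2" using xr by simp
    have dle: "deficiency w' \<le> deficiency w" unfolding deficiency_def by (rule sum_mono) (use le in auto)
    have "\<exists>w''. bounded_flow w'' \<and> deficiency w'' < deficiency w'"
    proof (rule less.IH[of j])
      show "j < n" using j kn by simp
      show "row w' u < 2" using less.prems(2) r'[of u] x2 tr by (auto split: if_splits)
      show "row w' (p j) = 3" using r'[of x] x2 xt by (simp add: x_def)
      show "(p i, p (Suc i)) \<in> exchange w'" if "i < j" for i
      proof -
        have "(p i, p (Suc i)) \<in> exchange w" using less.prems(5) that j kn by auto
        then obtain z where z: "adj (p i) z" "w (p (Suc i)) z > 0" by (auto simp: exchange_def)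
        have "p (Suc i) \<noteq> t" using before[of "Suc i"] that j tr by auto
        then have "w' (p (Suc i)) z > 0" using z by (auto simp: w'_def w1_def)
        then show ?thesis using z by (auto simp: exchange_def)
      qed
    qed (use bw' less.prems in auto)
    then show ?thesis using dle by fastforce
  qed
qed

text \<open>Let \<open>A\<close> be the set of left vertices reachable from \<open>u\<close>. If no
  vertex of \<open>A\<close> has row sum 3 and every vertex of \<open>N\<close> has column sum 3,
  then all weight arriving in \<open>N\<close> comes from \<open>A\<close>, so
  \<open>3 * card N\<close> is at most the total row sum of \<open>A\<close>. That total is below
  \<open>2 * card A\<close>, since \<open>u\<close> falls short of 2, and this contradicts
  \<open>expand\<close>.\<close>

lemma augment:
  assumes expand: "\<And>X. X \<subseteq> V \<Longrightarrow> 2 * card X \<le> 3 * card {y \<in> V. \<exists>x\<in>X. adj x y}"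
    and w: "bounded_flow w" and u: "row w u < 2" "u \<in> V"
  shows "\<exists>w'. bounded_flow w' \<and> deficiency w' < deficiency w"
proof -
  define A where "A = {z. (u, z) \<in> (exchange w)\<^sup>*}"
  have bf: "supported w" "\<And>v. v \<in> V \<Longrightarrow> row w v \<le> 3 \<and> col w v \<le> 3"
    using w by (auto simp: bounded_flow_def)
  have uA: "u \<in> A" by (simp add: A_def)
  have AV: "A \<subseteq> V"
  proof
    fix z assume "z \<in> A"
    then have "(u, z) \<in> (exchange w)\<^sup>*" by (simp add: A_def)
    then show "z \<in> V"
      by (induction rule: rtrancl_induct) (use u bf in \<open>auto simp: exchange_def supported_def dest: adj_in\<close>)
  qed
  define N where "N = {y \<in> V. \<exists>x\<in>A. adj x y}"
  have path: "\<exists>w'. bounded_flow w' \<and> deficiency w' < deficiency w1"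
    if "bounded_flow w1" "row w1 u < 2" "(u, z) \<in> (exchange w1)\<^sup>*" "row w1 z = 3" for w1 z
  proof -
    from that(3) obtain n where "(u, z) \<in> exchange w1 ^^ n" by (auto simp: rtrancl_power)
    then obtain p where "p 0 = u" "p n = z" "\<forall>i<n. (p i, p (Suc i)) \<in> exchange w1"
      by (auto simp: relpow_fun_conv)
    then show ?thesis using augment_path[of w1 u p n] that u by auto
  qed
  show ?thesis
  proof (cases "\<exists>z\<in>A. row w z = 3")
    case True
    then show ?thesis using path[OF w u(1)] by (auto simp: A_def)
  next
    case low: False
    show ?thesis
    proof (cases "\<exists>y\<in>N. col w y < 3")
      case True
      then obtain y z where yz: "y \<in> V" "z \<in> A" "adj z y" "col w y < 3" by (auto simp: N_def)
      have zV: "z \<in> V" using yz AV by auto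
      have zr: "row w z \<le> 2" using low yz(2) bf(2)[OF zV] by force
      define w1 where "w1 = w(z := (w z)(y := Suc (w z y)))"
      have g: "w z y \<le> row w z" "w z y \<le> col w y"
        using row_ge[OF yz(1)] zV finite_V unfolding col_def
        by (auto intro: member_le_sum[of _ _ "\<lambda>z. w z y"])
      have r1: "row w1 v = (if v = z then row w z + 1 else row w v)" for v
        unfolding w1_def using row_upd[OF yz(1), of w z _ v] g by auto
      have c1: "col w1 v = (if v = y then col w y + 1 else col w v)" for v
        unfolding w1_def using col_upd[OF zV, of w y _ v] g by auto
      have bw: "bounded_flow w1" unfolding bounded_flow_def
        using bf r1 c1 zr yz by (auto simp: supported_def w1_def)
      have le: "(2 - row w1 v) + (2 - col w1 v) \<le> (2 - row w v) + (2 - col w v)" for v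
        using r1[of v] c1[of v] by auto
      show ?thesis
      proof (cases "row w z < 2")
        case True
        have "deficiency w1 < deficiency w" unfolding deficiency_def
        proof (rule sum_strict_mono_ex1[OF finite_V])
          show "\<exists>a\<in>V. 2 - row w1 a + (2 - col w1 a) < 2 - row w a + (2 - col w a)"
            using True r1[of z] c1[of z] zV by (intro bexI[of _ z]) auto
        qed (use le in auto)
        then show ?thesis using bw by blast
      next
        case False
        then have z2: "row w z = 2" using zr by simp
        have dle: "deficiency w1 \<le> deficiency w" unfolding deficiency_def by (rule sum_mono) (use le in auto)
        \<comment> \<open>Raising a weight only adds exchange steps, so \<open>z\<close>, whose row
          sum is now 3, is still reachable from \<open>u\<close> and ends an augmenting path for
          \<open>w1\<close>.\<close>
        have "exchange w \<subseteq> exchange w1" by (auto simp: exchange_def w1_def)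
        then have "(u, z) \<in> (exchange w1)\<^sup>*" using yz(2) rtrancl_mono by (auto simp: A_def)
        moreover have "row w1 u < 2" using u z2 r1[of u] by auto
        ultimately show ?thesis using path[OF bw, of z] r1[of z] z2 dle by fastforce
      qed
    next
      case False
      then have full: "col w y = 3" if "y \<in> N" for y using that bf(2)[of y] by (force simp: N_def)
      have fA: "finite A" using AV finite_V finite_subset by blast
      have "3 * card N = (\<Sum>y\<in>N. col w y)" using full by simp
      also have "\<dots> = (\<Sum>y\<in>N. \<Sum>x\<in>A. w x y)"
      proof (rule sum.cong[OF refl])
        fix y assume "y \<in> N"
        then obtain x where x: "x \<in> A" "adj x y" by (auto simp: N_def)
        have "z \<in> A" if "w z y > 0" for z
        proof -
          have "(x, z) \<in> exchange w" using x that by (auto simp: exchange_def)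
          then show ?thesis using x by (auto simp: A_def)
        qed
        then show "col w y = (\<Sum>x\<in>A. w x y)" unfolding col_def
          by (intro sum.mono_neutral_right[OF finite_V AV]) auto
      qed
      also have "\<dots> = (\<Sum>x\<in>A. \<Sum>y\<in>N. w x y)" by (rule sum.swap)
      also have "\<dots> \<le> (\<Sum>x\<in>A. row w x)" unfolding row_def
        by (intro sum_mono sum_mono2[OF finite_V]) (auto simp: N_def)
      also have "\<dots> < (\<Sum>x\<in>A. 2)"
      proof (rule sum_strict_mono_ex1[OF fA])
        show "\<forall>x\<in>A. row w x \<le> 2" using low bf(2) AV by force
        show "\<exists>a\<in>A. row w a < 2" using u uA by auto
      qed
      also have "\<dots> = 2 * card A" by simp
      finally show ?thesis using expand[OF AV] by (simp add: N_def)
    qed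
  qed
qed

text \<open>Transposing a flow swaps the two sides and keeps \<open>deficiency\<close>, which counts
  both of them, so a minimal flow admits neither a row nor a column augmentation.\<close>

lemma two_sided_flow:
  assumes expand: "\<And>X. X \<subseteq> V \<Longrightarrow> 2 * card X \<le> 3 * card {y \<in> V. \<exists>x\<in>X. adj x y}"
  obtains w where "supported w" "\<And>x. x \<in> V \<Longrightarrow> row w x \<in> {2..3}" "\<And>x. x \<in> V \<Longrightarrow> col w x \<in> {2..3}"
proof -
  have "bounded_flow (\<lambda>x y. 0)" by (simp add: bounded_flow_def supported_def row_def col_def)
  from ex_has_least_nat[of bounded_flow, OF this, of deficiency]
  obtain w where w: "bounded_flow w" and least: "\<And>w'. bounded_flow w' \<Longrightarrow> deficiency w \<le> deficiency w'"
    by auto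
  let ?w = "\<lambda>x y. w y x"
  have flip: "row ?w = col w" "col ?w = row w"
    by (simp_all add: row_def col_def fun_eq_iff)
  have flipd: "deficiency ?w = deficiency w"
    unfolding deficiency_def flip by (simp add: add.commute)
  have flipb: "bounded_flow ?w"
    using w unfolding bounded_flow_def flip by (auto simp: supported_def dest: adj_sym)
  have no_gain: "\<not> (\<exists>w'. bounded_flow w' \<and> deficiency w' < deficiency w)"
    using least by (simp add: not_less)
  have "2 \<le> row w x" if "x \<in> V" for x
  proof (rule ccontr)
    assume "\<not> 2 \<le> row w x"
    with augment[OF expand w, of x] that no_gain show False by simp
  qed
  moreover have "2 \<le> col w x" if "x \<in> V" for x
  proof (rule ccontr)
    assume "\<not> 2 \<le> col w x"
    with augment[OF expand flipb, of x] that no_gain show False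
      unfolding flip flipd by simp
  qed
  ultimately show ?thesis using w that by (auto simp: bounded_flow_def)
qed

text \<open>A vertex with sum 3 or 7 lies on an edge of odd weight; changing that weight by 1 repairs the vertex,
  and the possible defect moves on while the number of odd weights drops.\<close>

lemma round_even:
  assumes "symmetric f" "supported f" "d \<in> V" "row f d \<in> {3..7}"
    "\<And>x. x \<in> V \<Longrightarrow> x \<noteq> d \<Longrightarrow> row f x \<in> {4..6}"
  shows "\<exists>g. symmetric g \<and> supported g \<and> (\<forall>x\<in>V. row g x \<in> {4..6}) \<and> (\<forall>x y. even (g x y))"
  using assms
proof (induction "card {(x, y). odd (f x y)}" arbitrary: f d rule: less_induct)
  case less
  have odd_adj: "adj x y" if "odd (f x y)" for x y
    using that less.prems(2) odd_pos by (auto simp: supported_def)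
  have fin: "finite {(x, y). odd (f x y)}"
    by (rule finite_subset[of _ "V \<times> V"]) (use odd_adj adj_in adj_in2 finite_V in blast)+
  have step: ?case
    if xy: "odd (f x y)" "row f x \<in> {3..7}" "\<And>v. v \<in> V \<Longrightarrow> v \<noteq> x \<Longrightarrow> row f v \<in> {4..6}" for x y
  proof -
    \<comment> \<open>Sums up to 5 are raised, 6 and 7 are lowered, so \<open>x\<close> lands in
      {4..6} in every case. The sum at \<open>y\<close> moves by 1 from {4..6}, hence stays in
      {3..7}, and \<open>y\<close> is the new \<open>d\<close>.\<close>
    define k where "k = (if row f x \<le> 5 then f x y + 1 else f x y - 1)"
    have a: "adj x y" using odd_adj xy by auto
    have V: "x \<in> V" "y \<in> V" "x \<noteq> y" using a adj_in adj_in2 adj_irrefl by auto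
    have pos: "f x y > 0" using xy(1) odd_pos by auto
    have le: "f x y \<le> row f x" "f x y \<le> row f y"
      using row_ge[of y f x] row_ge[of x f y] V less.prems(1) by (auto simp: symmetric_def)
    let ?g = "symupd f x y k"
    note r = row_symupd[OF V less.prems(1), of k]
    show ?case
    proof (rule less.hyps[of ?g y])
      have "{(u, v). odd (?g u v)} \<subset> {(u, v). odd (f u v)}"
        using xy(1) less.prems(1) by (auto simp: symupd_def k_def symmetric_def split: if_splits)
      then show "card {(u, v). odd (?g u v)} < card {(u, v). odd (f u v)}"
        by (rule psubset_card_mono[OF fin])
      show "symmetric ?g" "supported ?g"
        using less.prems a by (auto intro: symmetric_symupd supported_symupd)
      show "row ?g y \<in> {3..7}"
        using r[of y] xy(3)[of y] V le pos by (auto simp: k_def)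
      show "row ?g v \<in> {4..6}" if "v \<in> V" "v \<noteq> y" for v
        using r[of v] xy(2) xy(3)[of v] that V le pos by (auto simp: k_def)
    qed (use V in auto)
  qed
  show ?case
  proof (cases "row f d \<in> {4..6}")
    case True
    then have all: "row f x \<in> {4..6}" if "x \<in> V" for x using less.prems(5) that by metis
    show ?thesis
    proof (cases "\<exists>x y. odd (f x y)")
      case True
      \<comment> \<open>Even without a defect an odd weight may remain; an end of its edge can start
        the walk.\<close>
      then obtain x y where xy: "odd (f x y)" by auto
      then have "x \<in> V" using odd_adj adj_in by blast
      then show ?thesis using step[OF xy] all by fastforce
    next
      case False
      then show ?thesis using less.prems all by blast
    qed
  next
    case False
    then have "row f d = 3 \<or> row f d = 7" using less.prems(4) by auto
    then have "odd (row f d)" by auto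
    then obtain y where "odd (f d y)" unfolding row_def by (metis dvd_sum)
    then show ?thesis using step less.prems by blast
  qed
qed

lemma weighting_exists:
  assumes expand: "\<And>X. X \<subseteq> V \<Longrightarrow> 2 * card X \<le> 3 * card {y \<in> V. \<exists>x\<in>X. adj x y}"
  shows "\<exists>f. weighting f"
proof (cases "V = {}")
  case True
  then have "weighting (\<lambda>x y. 0)" unfolding weighting_def symmetric_def supported_def by auto
  then show ?thesis by blast
next
  case False
  then obtain d where d: "d \<in> V" by auto
  obtain w where w: "supported w" "\<And>x. x \<in> V \<Longrightarrow> row w x \<in> {2..3}" "\<And>x. x \<in> V \<Longrightarrow> col w x \<in> {2..3}"
    using two_sided_flow[OF expand] by blast
  define f where "f = (\<lambda>x y. w x y + w y x)"
  have "row f x = row w x + col w x" for x by (simp add: f_def row_def col_def sum.distrib)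
  then have rf: "row f x \<in> {4..6}" if "x \<in> V" for x using w(2,3)[OF that] by auto
  have "symmetric f" "supported f"
    using w(1) by (auto simp: f_def symmetric_def supported_def dest: adj_sym)
  from round_even[OF this d] rf d obtain g where
    g: "symmetric g" "supported g" "\<forall>x\<in>V. row g x \<in> {4..6}" "\<forall>x y. even (g x y)" by fastforce
  define h where "h = (\<lambda>x y. g x y div 2)"
  \<comment> \<open>The row sums of \<open>g\<close> lie in {4..6} and are even, so they are 4 or 6
    and halve to 2 or 3.\<close>
  have "g x y = 2 * h x y" for x y using g(4) by (simp add: h_def)
  then have "row g x = 2 * row h x" for x by (simp add: row_def sum_distrib_left)
  then have "row h x \<in> {2, 3}" if "x \<in> V" for x using g(3) that by force
  moreover have "symmetric h" "supported h" using g(1,2) by (auto simp: h_def symmetric_def supported_def)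
  ultimately show ?thesis by (auto simp: weighting_def)
qed

end

section \<open>Weightings of minimum cost\<close>

context adjacency
begin

text \<open>The sum runs over ordered pairs, so every edge counts twice. The surcharge 2 per edge is
  calibrated by \<open>mid_mid_triangle\<close>, whose exchange removes an edge while the total
  weight grows by 1: a surcharge of 1 would only tie.\<close>

definition cost :: "('a \<Rightarrow> 'a \<Rightarrow> nat) \<Rightarrow> nat" where
  "cost f = (\<Sum>x\<in>V. \<Sum>y\<in>V. if f x y = 0 then 0 else f x y + 2)"

lemma sum_row_symupd:
  assumes "x \<in> V" "y \<in> V" "x \<noteq> y" "symmetric f"
  shows "(\<Sum>u\<in>V. row (symupd f x y k) u) + 2 * f x y = (\<Sum>u\<in>V. row f u) + 2 * k"
proof -
  let ?W = "V - {x} - {y}"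
  have split: "(\<Sum>u\<in>V. g u) = g x + (g y + (\<Sum>u\<in>?W. g u))" for g :: "'a \<Rightarrow> nat"
    using assms finite_V by (simp add: sum.remove[of V x] sum.remove[of "V - {x}" y])
  have "(\<Sum>u\<in>?W. row (symupd f x y k) u) = (\<Sum>u\<in>?W. row f u)"
    by (rule sum.cong) (auto simp: row_symupd assms)
  moreover have "f x y \<le> row f x" "f x y \<le> row f y"
    using row_ge[of y f x] row_ge[of x f y] assms by (auto simp: symmetric_def)
  ultimately show ?thesis
    using split[of "row f"] split[of "row (symupd f x y k)"]
    by (simp add: row_symupd assms)
qed

text \<open>Charging each entry commutes with \<open>symupd\<close>, so the identity for row sums
  applies to the charged function. The additive form avoids natural subtraction.\<close>

lemma cost_symupd:
  assumes "x \<in> V" "y \<in> V" "x \<noteq> y" "symmetric f"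
  shows "cost (symupd f x y k) + 2 * (if f x y = 0 then 0 else f x y + 2) =
    cost f + 2 * (if k = 0 then 0 else k + 2)"
proof -
  let ?F = "\<lambda>f u v. if f u v = 0 then 0 else f u v + 2 :: nat"
  have "?F (symupd f x y k) = symupd (?F f) x y (if k = 0 then 0 else k + 2)"
    by (auto simp: symupd_def fun_eq_iff)
  moreover have "symmetric (?F f)" using assms(4) by (simp add: symmetric_def)
  moreover have "cost f = (\<Sum>u\<in>V. row (?F f) u)" for f by (simp add: cost_def row_def)
  ultimately show ?thesis using sum_row_symupd[OF assms(1-3), of "?F f" "if k = 0 then 0 else k + 2"]
    by simp
qed

end

locale optimal_weighting = adjacency +
  fixes f :: "'a \<Rightarrow> 'a \<Rightarrow> nat"
  assumes wt: "weighting f"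
    and optimal: "weighting g \<Longrightarrow> cost f \<le> cost g"
begin

definition nbrs :: "'a \<Rightarrow> 'a set" where
  "nbrs x = {y. f x y > 0}"

text \<open>In components other than P_2 and C_3, the \<open>big\<close> vertices will be the
  vertices of R, the \<open>mid\<close> ones will subdivide its edges, and the \<open>tip\<close>
  ones will be the ends of the pendant edges.\<close>

definition big :: "'a \<Rightarrow> bool" where
  "big x \<longleftrightarrow> x \<in> V \<and> row f x = 3"

definition mid :: "'a \<Rightarrow> bool" where
  "mid x \<longleftrightarrow> x \<in> V \<and> row f x = 2 \<and> (\<forall>y. f x y \<le> 1)"

definition tip :: "'a \<Rightarrow> bool" where
  "tip x \<longleftrightarrow> x \<in> V \<and> row f x = 2 \<and> (\<exists>y. f x y = 2)"

lemma f_sym: "symmetric f" and f_comm: "f x y = f y x" and f_adj: "f x y > 0 \<Longrightarrow> adj x y"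
  and row23: "x \<in> V \<Longrightarrow> row f x = 2 \<or> row f x = 3"
  using wt by (auto simp: weighting_def symmetric_def supported_def)

lemma f_in: "f x y > 0 \<Longrightarrow> x \<in> V \<and> y \<in> V \<and> x \<noteq> y"
  using f_adj adj_in adj_in2 adj_irrefl by metis

lemma nbrs_sym: "y \<in> nbrs x \<longleftrightarrow> x \<in> nbrs y"
  using f_comm by (simp add: nbrs_def)

lemma nbrs_V: "nbrs x \<subseteq> V"
  using f_in by (auto simp: nbrs_def)

lemma finite_nbrs: "finite (nbrs x)"
  using nbrs_V finite_V finite_subset by blast

lemma row_nbrs: "row f x = (\<Sum>y\<in>nbrs x. f x y)"
  unfolding row_def by (rule sum.mono_neutral_right[OF finite_V nbrs_V]) (auto simp: nbrs_def)

lemma row_ge_f: "f x y \<le> row f x"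
  using row_ge[of y f x] f_in[of x y] by (cases "f x y = 0") auto

lemma row_remove: "y \<in> nbrs x \<Longrightarrow> row f x = f x y + (\<Sum>z\<in>nbrs x - {y}. f x z)"
  unfolding row_nbrs using finite_nbrs by (simp add: sum.remove)

section \<open>Patterns excluded by local exchanges\<close>

lemma improve:
  assumes "weighting g" shows "\<not> cost g < cost f"
  using optimal[OF assms] by simp

text \<open>If both ends had sum 3, lowering the weight of the edge by 1 would leave them at 2 and
  be cheaper.\<close>

lemma light_end:
  assumes "f x y > 0" shows "row f x = 2 \<or> row f y = 2"
proof (rule ccontr)
  assume c: "\<not> ?thesis"
  have V: "x \<in> V" "y \<in> V" "x \<noteq> y" using f_in assms by auto
  then have r: "row f x = 3" "row f y = 3" using c row23 by auto
  let ?g = "symupd f x y (f x y - 1)"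
  have "row ?g u \<in> {2, 3}" if "u \<in> V" for u
    using row_symupd[OF V f_sym, of "f x y - 1" u] r assms row23[OF that] row_ge_f[of x y] by auto
  then have "weighting ?g"
    using wt f_adj assms by (auto simp: weighting_def intro: symmetric_symupd supported_symupd)
  moreover have "cost ?g < cost f" using cost_symupd[OF V f_sym, of "f x y - 1"] assms by (auto split: if_splits)
  ultimately show False using improve by blast
qed

lemma f_le2: "f x y \<le> 2"
proof (cases "f x y = 0")
  case False
  then have "row f x = 2 \<or> row f y = 2" using light_end by simp
  then show ?thesis using row_ge_f[of x y] row_ge_f[of y x] f_comm[of x y] by auto
qed simp

lemma rest_empty: 
  assumes "y \<in> nbrs x" "row f x = f x y" shows "nbrs x = {y}"
proof -
  have "(\<Sum>z\<in>nbrs x - {y}. f x z) = 0" using row_remove[OF assms(1)] assms(2) by simp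
  then have zero: "f x z = 0" if "z \<in> nbrs x - {y}" for z using finite_nbrs that by simp
  have "z = y" if "z \<in> nbrs x" for z using zero[of z] that unfolding nbrs_def by auto
  then show ?thesis using assms(1) by blast
qed

lemma card_nbrs:
  assumes "\<And>y. f x y \<le> 1" shows "card (nbrs x) = row f x"
proof -
  have "f x y = 1" if "y \<in> nbrs x" for y using assms[of y] that by (simp add: nbrs_def)
  then show ?thesis unfolding row_nbrs by simp
qed

lemma tip_nbrs: "tip x \<Longrightarrow> \<exists>y. nbrs x = {y} \<and> f x y = 2"
  using rest_empty by (force simp: tip_def nbrs_def)

lemma mid_nbrs: "mid x \<Longrightarrow> card (nbrs x) = 2"
  by (simp add: card_nbrs mid_def)

lemma mid_f: "mid x \<Longrightarrow> y \<in> nbrs x \<Longrightarrow> f x y = 1"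
  by (auto simp: mid_def nbrs_def intro: antisym)

lemma trichotomy: "x \<in> V \<Longrightarrow> big x \<or> mid x \<or> tip x"
proof -
  assume x: "x \<in> V"
  have "mid x \<or> tip x" if "row f x = 2"
  proof (cases "\<exists>y. f x y = 2")
    case False
    then have "f x y \<le> 1" for y using f_le2[of x y] by (metis One_nat_def le_SucE numeral_2_eq_2)
    then show ?thesis using that x by (simp add: mid_def)
  qed (use that x in \<open>auto simp: tip_def\<close>)
  then show ?thesis using row23[OF x] x by (auto simp: big_def)
qed

lemma exclusive: "\<not> (big x \<and> mid x)" "\<not> (big x \<and> tip x)" "\<not> (mid x \<and> tip x)"
  by (auto simp: big_def mid_def tip_def) (metis One_nat_def numeral_2_eq_2 not_less_eq_eq order_refl)

lemma big_nbrs_light: "big x \<Longrightarrow> y \<in> nbrs x \<Longrightarrow> mid y \<or> tip y"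
  using light_end[of x y] trichotomy[of y] nbrs_V[of x] by (auto simp: big_def nbrs_def)

text \<open>The only edge at a \<open>tip\<close> has weight 2, while edges at a \<open>mid\<close>
  have weight 1.\<close>

lemma mid_nbr_not_tip: "mid x \<Longrightarrow> y \<in> nbrs x \<Longrightarrow> \<not> tip y"
  using tip_nbrs[of y] mid_f[of x y] nbrs_sym[of x y] f_comm[of x y] by force

text \<open>With weights at most 2, the sum 3 splits as 1 + 1 + 1 or as 2 + 1. The other end of an
  edge of weight 2 is a \<open>tip\<close>, that of an edge of weight 1 is a \<open>mid\<close>. The
  two cases are the vertices of degree 3 and the leaves of R.\<close>

lemma big_nbrs:
  assumes "big x"
  shows "card (nbrs x \<inter> {y. mid y}) = 3 \<and> nbrs x \<inter> {y. tip y} = {} \<or>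
    card (nbrs x \<inter> {y. mid y}) = 1 \<and> card (nbrs x \<inter> {y. tip y}) = 1"
proof (cases "\<exists>y. f x y = 2")
  case True
  then obtain y where y: "f x y = 2" by auto
  then have yn: "y \<in> nbrs x" by (simp add: nbrs_def)
  have rest: "(\<Sum>z\<in>nbrs x - {y}. f x z) = 1" using row_remove[OF yn] y assms by (simp add: big_def)
  then have "\<exists>z\<in>nbrs x - {y}. f x z = 1 \<and> (\<forall>v\<in>nbrs x - {y}. z \<noteq> v \<longrightarrow> f x v = 0)"
    using sum_eq_1_iff[of "nbrs x - {y}" "f x"] finite_nbrs by blast
  then obtain z where z: "z \<in> nbrs x - {y}" "f x z = 1" "\<forall>v\<in>nbrs x - {y}. z \<noteq> v \<longrightarrow> f x v = 0"
    by blast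
  have "v = y \<or> v = z" if "v \<in> nbrs x" for v using z(3) that unfolding nbrs_def by auto
  then have n: "nbrs x = {y, z}" "y \<noteq> z" using yn z(1) by blast+
  have "tip y"
  proof -
    have "\<not> mid y" using mid_f[of y x] yn nbrs_sym[of y x] f_comm[of x y] y by auto
    then show ?thesis using big_nbrs_light[OF assms yn] by blast
  qed
  moreover have "mid z"
  proof -
    have "\<not> tip z"
    proof
      assume "tip z"
      then obtain u where u: "nbrs z = {u}" "f z u = 2" using tip_nbrs by blast
      then have "x = u" using z(1) nbrs_sym[of z x] by blast
      then show False using u z(2) f_comm[of x z] by simp
    qed
    then show ?thesis using big_nbrs_light[OF assms, of z] z by blast
  qed
  ultimately have "nbrs x \<inter> {y. mid y} = {z}" "nbrs x \<inter> {y. tip y} = {y}"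
    using n exclusive(3) by auto
  then show ?thesis by simp
next
  case False
  have le1: "f x y \<le> 1" for y using False f_le2[of x y] by (metis One_nat_def le_SucE numeral_2_eq_2)
  have "\<not> tip y" if "y \<in> nbrs x" for y
  proof
    assume "tip y"
    then obtain u where u: "nbrs y = {u}" "f y u = 2" using tip_nbrs by blast
    then have "x = u" using that nbrs_sym[of y x] by blast
    then show False using u False f_comm[of x y] by simp
  qed
  then have "nbrs x \<inter> {y. mid y} = nbrs x" "nbrs x \<inter> {y. tip y} = {}"
    using big_nbrs_light[OF assms] by auto
  then show ?thesis using card_nbrs[OF le1] assms by (simp add: big_def)
qed

lemma mid_other:
  assumes "mid m" "y \<in> nbrs m"
  obtains a where "nbrs m = {y, a}" "a \<noteq> y"
proof -
  have "card (nbrs m - {y}) = 1" using mid_nbrs[OF assms(1)] assms(2) finite_nbrs by simp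
  then obtain a where "nbrs m - {y} = {a}" by (auto simp: card_1_singleton_iff)
  then show ?thesis using that[of a] assms(2) by auto
qed

text \<open>Otherwise the edge from \<open>m\<close> to \<open>a\<close> could be dropped and the
  one from \<open>m\<close> to \<open>m'\<close> doubled: \<open>a\<close> falls to 2,
  \<open>m'\<close> rises to 3, \<open>m\<close> stays at 2, and one edge is saved at equal total
  weight.\<close>

lemma mid_mid_not_big:
  assumes "mid m" "mid m'" "nbrs m = {m', a}" "a \<noteq> m'"
  shows "\<not> big a"
proof
  assume a: "big a"
  have f1: "f m m' = 1" "f m a = 1" using mid_f[OF assms(1)] assms(3) by auto
  have V: "m \<in> V" "m' \<in> V" "a \<in> V" "m \<noteq> m'" "m \<noteq> a" using f_in[of m m'] f_in[of m a] f1 by auto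
  let ?g1 = "symupd f m a 0" let ?g = "symupd ?g1 m m' 2"
  have s1: "symmetric ?g1" using f_sym by (rule symmetric_symupd)
  have g1: "?g1 m m' = 1" using f1 V assms(4) by (simp add: symupd_def)
  note r1 = row_symupd[OF V(1,3,5) f_sym, of 0] and r = row_symupd[OF V(1,2,4) s1, of 2]
  have rr: "row f m = 2" "row f m' = 2" "row f a = 3" using a assms(1,2) by (auto simp: mid_def big_def)
  have "row ?g u \<in> {2, 3}" if "u \<in> V" for u
    using row23[OF that] rr f1 g1 V assms(4) by (auto simp: r r1)
  then have "weighting ?g"
    using s1 wt f_adj f1 by (auto simp: weighting_def intro!: symmetric_symupd supported_symupd)
  moreover have "cost ?g < cost f"
    using cost_symupd[OF V(1,3,5) f_sym, of 0] cost_symupd[OF V(1,2,4) s1, of 2] f1 g1 by simp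
  ultimately show False using improve by blast
qed

text \<open>For distinct \<open>a\<close> and \<open>b\<close>, drop the edge from \<open>m\<close>
  to \<open>m'\<close> and double the edges to \<open>a\<close> and \<open>b\<close>. These are not
  \<open>big\<close>, so they rise from 2 to 3. For \<open>a = b\<close> the sum would become 4,
  which is why triangles survive.\<close>

lemma mid_mid_triangle:
  assumes "mid m" "mid m'" "nbrs m = {m', a}" "a \<noteq> m'" "nbrs m' = {m, b}" "b \<noteq> m"
  shows "a = b"
proof (rule ccontr)
  assume ab: "a \<noteq> b"
  have f1: "f m m' = 1" "f m a = 1" "f m' b = 1"
    using mid_f[OF assms(1)] mid_f[OF assms(2)] assms(3,5) by auto
  have V: "m \<in> V" "m' \<in> V" "a \<in> V" "b \<in> V" "m \<noteq> m'" "m \<noteq> a" "m' \<noteq> b"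
    using f_in[of m m'] f_in[of m a] f_in[of m' b] f1 by auto
  let ?g1 = "symupd f m m' 0" let ?g2 = "symupd ?g1 m a 2" let ?g = "symupd ?g2 m' b 2"
  have s1: "symmetric ?g1" using f_sym by (rule symmetric_symupd)
  have s2: "symmetric ?g2" using s1 by (rule symmetric_symupd)
  have g1: "?g1 m a = 1" "?g2 m' b = 1" using f1 V assms(4,6) ab by (auto simp: symupd_def)
  note r1 = row_symupd[OF V(1,2,5) f_sym, of 0] and r2 = row_symupd[OF V(1,3,6) s1, of 2]
    and r = row_symupd[OF V(2,4,7) s2, of 2]
  have "\<not> big a" "\<not> big b"
    using mid_mid_not_big[OF assms(1-4)] mid_mid_not_big[OF assms(2,1,5,6)] by auto
  then have rr: "row f m = 2" "row f m' = 2" "row f a = 2" "row f b = 2"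
    using assms(1,2) row23[OF V(3)] row23[OF V(4)] V by (auto simp: mid_def big_def)
  have "row ?g u \<in> {2, 3}" if "u \<in> V" for u
    using row23[OF that] rr f1 g1 V assms(4,6) ab by (auto simp: r r1 r2)
  then have "weighting ?g"
    using s2 wt f_adj f1 by (auto simp: weighting_def intro!: symmetric_symupd supported_symupd)
  moreover have "cost ?g < cost f"
    using cost_symupd[OF V(1,2,5) f_sym, of 0] cost_symupd[OF V(1,3,6) s1, of 2]
      cost_symupd[OF V(2,4,7) s2, of 2] f1 g1 by simp
  ultimately show False using improve by blast
qed

text \<open>The third vertex \<open>a\<close> is neither \<open>big\<close> nor \<open>tip\<close>,
  so it is \<open>mid\<close>, and \<open>m\<close> and \<open>m'\<close> already account for its
  two neighbours.\<close>

lemma mid_mid_component: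
  assumes "mid m" "mid m'" "m' \<in> nbrs m"
  obtains a where "m \<noteq> m'" "a \<noteq> m" "a \<noteq> m'" "nbrs m = {m', a}" "nbrs m' = {m, a}" "nbrs a = {m, m'}"
proof -
  obtain a where a: "nbrs m = {m', a}" "a \<noteq> m'" using mid_other assms by blast
  have "m \<in> nbrs m'" using assms(3) nbrs_sym by blast
  then obtain b where b: "nbrs m' = {m, b}" "b \<noteq> m" using mid_other assms by blast
  have ab: "a = b" using mid_mid_triangle[OF assms(1,2) a b] .
  have am: "m \<in> nbrs a" "m' \<in> nbrs a" using a b ab nbrs_sym[of a] by auto
  have "mid a"
    using mid_mid_not_big[OF assms(1,2) a] trichotomy[of a] mid_nbr_not_tip[OF assms(1), of a] a nbrs_V by auto
  then have "card (nbrs a) = 2" by (rule mid_nbrs)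
  moreover have "m \<noteq> m'" using assms(3) f_in by (auto simp: nbrs_def)
  ultimately have "nbrs a = {m, m'}" using am finite_nbrs
    by (metis card_2_iff card_subset_eq empty_subsetI insert_subset)
  then show ?thesis using that a b ab \<open>m \<noteq> m'\<close> by auto
qed

lemma sum_exchange:
  assumes "p \<in> V" "q \<in> V" "p \<noteq> q" "\<And>v. v \<in> V \<Longrightarrow> v \<noteq> p \<Longrightarrow> v \<noteq> q \<Longrightarrow> g v = h v"
  shows "(\<Sum>v\<in>V. g v) + h p + h q = (\<Sum>v\<in>V. h v) + g p + (g q :: nat)"
proof -
  let ?W = "V - {p} - {q}"
  have split: "(\<Sum>u\<in>V. g u) = g p + (g q + (\<Sum>u\<in>?W. g u))" for g :: "'a \<Rightarrow> nat"
    using assms(1-3) finite_V by (simp add: sum.remove[of V p] sum.remove[of "V - {p}" q])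
  have "(\<Sum>u\<in>?W. g u) = (\<Sum>u\<in>?W. h u)" by (rule sum.cong) (use assms in auto)
  then show ?thesis using split[of g] split[of h] by simp
qed

text \<open>The permutation \<open>\<sigma>\<close> walks along disjoint cycles through the vertices of \<open>A\<close>, with \<open>\<mu> a\<close> between
  \<open>a\<close> and \<open>\<sigma> a\<close>; making the weights alternate between 2 and 0 would save support.\<close>

lemma no_alternating_cycle:
  assumes "A \<noteq> {}" "\<And>a. a \<in> A \<Longrightarrow> big a" "bij_betw \<sigma> A A" "\<And>a. a \<in> A \<Longrightarrow> \<sigma> a \<noteq> a"
    "inj_on \<mu> A" "\<And>a. a \<in> A \<Longrightarrow> mid (\<mu> a)" "\<And>a. a \<in> A \<Longrightarrow> nbrs (\<mu> a) = {a, \<sigma> a}"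
  shows False
proof -
  define P where "P = {(x, y). \<exists>a\<in>A. x = a \<and> y = \<mu> a \<or> y = a \<and> x = \<mu> a}"
  define Z where "Z = {(x, y). \<exists>a\<in>A. x = \<sigma> a \<and> y = \<mu> a \<or> y = \<sigma> a \<and> x = \<mu> a}"
  define g where "g = (\<lambda>x y. if (x, y) \<in> P then 2 else if (x, y) \<in> Z then 0 else f x y)"
  have sA: "\<sigma> a \<in> A" if "a \<in> A" for a using assms(3) that by (auto simp: bij_betw_def)
  have sinj: "a = b" if "\<sigma> a = \<sigma> b" "a \<in> A" "b \<in> A" for a b
    using assms(3) that by (auto simp: bij_betw_def dest: inj_onD)
  have minj: "a = b" if "\<mu> a = \<mu> b" "a \<in> A" "b \<in> A" for a b using assms(5) that by (auto dest: inj_onD)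
  have mA: "\<mu> a \<notin> A" if "a \<in> A" for a using assms(2,6) that exclusive(1) by blast
  have ms: "\<mu> a \<noteq> \<sigma> b" if "a \<in> A" "b \<in> A" for a b using mA[OF that(1)] sA[OF that(2)] by auto
  have fa: "f (\<mu> a) a = 1" "f (\<mu> a) (\<sigma> a) = 1" "f a (\<mu> a) = 1" "f (\<sigma> a) (\<mu> a) = 1" if "a \<in> A" for a
    using mid_f[OF assms(6)[OF that]] assms(7)[OF that] f_comm[of "\<mu> a"] by auto
  have ga: "g a (\<mu> a) = 2" "g (\<mu> a) a = 2" if "a \<in> A" for a using that by (auto simp: g_def P_def)
  \<comment> \<open>\<open>P\<close> and \<open>Z\<close> are disjoint, so the order of the tests in
    \<open>g\<close> is harmless: as \<open>\<mu> a\<close> is outside \<open>A\<close>, a common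
    pair would force \<open>\<mu> (\<sigma> a) = \<mu> a\<close>, against injectivity and
    \<open>\<sigma> a \<noteq> a\<close>.\<close>
  have notP: "(\<sigma> a, \<mu> a) \<notin> P" "(\<mu> a, \<sigma> a) \<notin> P" if "a \<in> A" for a
    using that minj[of a "\<sigma> a"] mA assms(4)[OF that] sA[OF that] by (auto simp: P_def)
  have gs: "g (\<sigma> a) (\<mu> a) = 0" "g (\<mu> a) (\<sigma> a) = 0" if "a \<in> A" for a
    using that notP[OF that] by (auto simp: g_def Z_def)
  have same: "g x y = f x y" if "(x, y) \<notin> P" "(x, y) \<notin> Z" for x y using that by (simp add: g_def)
  define \<phi> where "\<phi> = (\<lambda>n::nat. if n = 0 then 0 else n + 2)"
  have key: "row g x = row f x \<and> (\<Sum>y\<in>V. \<phi> (g x y)) \<le> (\<Sum>y\<in>V. \<phi> (f x y)) \<and>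
      (x \<in> A \<longrightarrow> (\<Sum>y\<in>V. \<phi> (g x y)) < (\<Sum>y\<in>V. \<phi> (f x y)))" if x: "x \<in> V" for x
  proof -
    \<comment> \<open>A vertex on a cycle trades two edges of weight 1, charged 3 each, for one edge
      of weight 2, charged 4, and keeps its row sum.\<close>
    have two: ?thesis if "p \<in> V" "q \<in> V" "p \<noteq> q" "f x p = 1" "f x q = 1" "g x p = 2" "g x q = 0"
      "\<And>y. y \<noteq> p \<Longrightarrow> y \<noteq> q \<Longrightarrow> g x y = f x y" for p q
      using sum_exchange[OF that(1-3), of "g x" "f x"]
        sum_exchange[OF that(1-3), of "\<lambda>y. \<phi> (g x y)" "\<lambda>y. \<phi> (f x y)"] that(4-8)
      by (simp add: row_def \<phi>_def)
    show ?thesis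
    proof (cases "x \<in> A")
      case True
      \<comment> \<open>\<open>b\<close> is the predecessor of \<open>x\<close>: the edge to
        \<open>\<mu> x\<close> is doubled, the one to \<open>\<mu> b\<close> disappears.\<close>
      obtain b where b: "b \<in> A" "\<sigma> b = x" using assms(3) True by (metis bij_betw_imp_surj_on imageE)
      show ?thesis
      proof (rule two[of "\<mu> x" "\<mu> b"])
        show "\<mu> x \<noteq> \<mu> b" using minj True b assms(4) by metis
        show "f x (\<mu> b) = 1" "g x (\<mu> b) = 0" using fa[OF b(1)] gs[OF b(1)] b by auto
        show "g x y = f x y" if "y \<noteq> \<mu> x" "y \<noteq> \<mu> b" for y
          by (rule same) (use that True b mA sinj in \<open>auto simp: P_def Z_def\<close>)
      qed (use True b fa ga f_in assms(6) in \<open>auto simp: mid_def\<close>)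
    next
      case xA: False
      show ?thesis
      proof (cases "x \<in> \<mu> ` A")
        case True
        then obtain a where a: "a \<in> A" "x = \<mu> a" by auto
        show ?thesis
        proof (rule two[of a "\<sigma> a"])
          show "g x y = f x y" if "y \<noteq> a" "y \<noteq> \<sigma> a" for y
            by (rule same) (use that a minj mA xA sA ms in \<open>auto simp: P_def Z_def\<close>)
          show "a \<noteq> \<sigma> a" using assms(4) a by metis
        qed (use a fa ga gs sA assms(2) in \<open>auto simp: big_def\<close>)
      next
        case False
        have "g x y = f x y" for y
          by (rule same) (use xA False sA in \<open>auto simp: P_def Z_def\<close>)
        then show ?thesis using xA by (simp add: row_def)
      qed
    qed
  qed
  have "symmetric g"
    unfolding symmetric_def g_def by (auto simp: f_comm P_def Z_def)
  moreover have "supported g"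
    unfolding supported_def
  proof (intro allI impI)
    fix x y assume "g x y > 0"
    then have "f x y > 0" using fa unfolding g_def P_def by (auto split: if_splits)
    then show "adj x y" by (rule f_adj)
  qed
  ultimately have "weighting g" using key row23 by (auto simp: weighting_def)
  moreover have "cost g < cost f"
  proof -
    have AV: "A \<subseteq> V" using assms(2) by (auto simp: big_def)
    have c: "cost h = (\<Sum>x\<in>V. \<Sum>y\<in>V. \<phi> (h x y))" for h by (simp add: cost_def \<phi>_def)
    show ?thesis unfolding c
      by (rule sum_strict_mono_ex1[OF finite_V]) (use key AV assms(1) in auto)
  qed
  ultimately show False using improve by blast
qed

text \<open>Two such vertices would give parallel edges of R. With their common neighbours
  \<open>a\<close> and \<open>b\<close> they form a 4-cycle, an alternating cycle whose permutation
  swaps \<open>a\<close> and \<open>b\<close>.\<close>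

lemma mid_determined:
  assumes "mid m" "mid m'" "nbrs m = nbrs m'" "\<And>a. a \<in> nbrs m \<Longrightarrow> big a"
  shows "m = m'"
proof (rule ccontr)
  assume ne: "m \<noteq> m'"
  obtain a b where ab: "nbrs m = {a, b}" "a \<noteq> b"
    using mid_nbrs[OF assms(1)] by (auto simp: card_2_iff)
  show False
    by (rule no_alternating_cycle[of "{a, b}" "\<lambda>x. if x = a then b else a" "\<lambda>x. if x = a then m else m'"])
      (use ne ab assms in \<open>auto simp: bij_betw_def inj_on_def\<close>)
qed

end

lemma (in adjacency) optimal_weighting_exists:
  assumes "weighting g"
  shows "\<exists>f. optimal_weighting V adj f"
proof -
  obtain f where "weighting f" "\<And>g. weighting g \<Longrightarrow> cost f \<le> cost g"
    using ex_has_least_nat[of weighting, OF assms, of cost] by auto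
  then have "optimal_weighting V adj f" by unfold_locales
  then show ?thesis by blast
qed

section \<open>Recognising members of the tree family\<close>

lemma edge_ends:
  assumes "finite_simple_graph G" "{x, y} \<in> edges G"
  shows "x \<in> verts G" "y \<in> verts G" "x \<noteq> y"
  using assms by (force simp: finite_simple_graph_def)+

lemma edge_pair:
  assumes "finite_simple_graph G" "e \<in> edges G"
  obtains x y where "e = {x, y}" "x \<noteq> y"
  using assms by (metis finite_simple_graph_def card_2_iff)

text \<open>A local description of T_R, in which \<open>B\<close>, \<open>M\<close> and
  \<open>L\<close> are to become the vertices \<open>Orig\<close>, \<open>Mid\<close> and
  \<open>Pend\<close>. Injectivity of \<open>N\<close> on \<open>M\<close> says that R has no
  parallel edges. Acyclicity of R is phrased through a permutation \<open>\<sigma>\<close> of a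
  subset of \<open>B\<close>, the form in which \<open>no_alternating_cycle\<close> supplies
  it.\<close>

locale subdivided_tree =
  fixes C :: "'a ugraph" and B M L :: "'a set" and N :: "'a \<Rightarrow> 'a set"
  assumes simple: "finite_simple_graph C" and conn: "connected_graph C"
    and N_def: "N x = {y. {x, y} \<in> edges C}"
    and verts_C: "verts C = B \<union> M \<union> L"
    and disj: "B \<inter> M = {}" "B \<inter> L = {}" "M \<inter> L = {}"
    and N_M: "x \<in> M \<Longrightarrow> N x \<subseteq> B \<and> card (N x) = 2"
    and N_L: "x \<in> L \<Longrightarrow> N x \<subseteq> B \<and> card (N x) = 1"
    and N_B: "x \<in> B \<Longrightarrow> N x \<subseteq> M \<union> L"
    and N_B_card: "x \<in> B \<Longrightarrow> card (N x \<inter> M) = 3 \<and> N x \<inter> L = {} \<or>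
      card (N x \<inter> M) = 1 \<and> card (N x \<inter> L) = 1"
    and inj_N: "inj_on N M"
    and no_cycle: "\<lbrakk>A \<noteq> {}; A \<subseteq> B; bij_betw \<sigma> A A; \<And>a. a \<in> A \<Longrightarrow> \<sigma> a \<noteq> a; inj_on \<mu> A;
      \<And>a. a \<in> A \<Longrightarrow> \<mu> a \<in> M \<and> N (\<mu> a) = {a, \<sigma> a}\<rbrakk> \<Longrightarrow> False"
begin

lemma N_sym: "y \<in> N x \<longleftrightarrow> x \<in> N y"
  by (simp add: N_def insert_commute)

lemma N_verts: "y \<in> N x \<Longrightarrow> x \<in> verts C \<and> y \<in> verts C"
  using edge_ends[OF simple] by (auto simp: N_def)

lemma finite_verts: "finite (verts C)"
  using simple by (simp add: finite_simple_graph_def)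

lemma B_verts: "B \<subseteq> verts C"
  by (auto simp: verts_C)

lemma pendant_unique:
  assumes "l \<in> L" "l' \<in> L" "N l = N l'" shows "l = l'"
proof -
  obtain a where a: "N l = {a}" using N_L[OF assms(1)] by (auto simp: card_1_singleton_iff)
  then have "l \<in> N a \<inter> L" "l' \<in> N a \<inter> L" "a \<in> B" using assms N_sym N_L by blast+
  then have "l \<in> N a \<inter> L" "l' \<in> N a \<inter> L" "card (N a \<inter> L) = 1" using N_B_card[of a] by auto
  then show ?thesis by (metis card_1_singletonE singletonD)
qed

section \<open>The {1,3}-tree underlying a subdivided tree\<close>

context
  fixes g :: "'a \<Rightarrow> nat"
  assumes g: "inj_on g (verts C)"
begin

text \<open>\<open>T3\<close> is built from trees on the natural numbers, hence the labels
  \<open>g\<close>. A vertex of \<open>M\<close> turns into the edge formed by its two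
  neighbours.\<close>

definition R :: "nat ugraph" where
  "R = \<lparr>verts = g ` B, edges = (\<lambda>m. g ` N m) ` M\<rparr>"

lemma g_eq: "x \<in> verts C \<Longrightarrow> y \<in> verts C \<Longrightarrow> g x = g y \<longleftrightarrow> x = y"
  using g by (auto dest: inj_onD)

lemma g_image_eq: "X \<subseteq> B \<Longrightarrow> Y \<subseteq> B \<Longrightarrow> g ` X = g ` Y \<longleftrightarrow> X = Y"
  by (rule inj_on_image_eq_iff[OF g]) (use B_verts in auto)

lemma g_mem: "a \<in> B \<Longrightarrow> X \<subseteq> B \<Longrightarrow> g a \<in> g ` X \<longleftrightarrow> a \<in> X"
  by (rule inj_on_image_mem_iff[OF g]) (use B_verts in auto)

lemma R_simple: "finite_simple_graph R"
  unfolding finite_simple_graph_def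
proof (intro conjI ballI)
  show "finite (verts R)" using finite_verts B_verts finite_subset by (auto simp: R_def)
  fix e assume "e \<in> edges R"
  then obtain m where m: "m \<in> M" "e = g ` N m" by (auto simp: R_def)
  then show "e \<subseteq> verts R" using N_M by (auto simp: R_def)
  have "inj_on g (N m)" using g N_M[OF m(1)] B_verts by (meson inj_on_subset subset_trans)
  then show "card e = 2" using m N_M by (simp add: card_image)
qed

text \<open>Since \<open>N\<close> is injective on \<open>M\<close>, distinct subdividing vertices
  next to \<open>a\<close> yield distinct edges.\<close>

lemma R_degree:
  assumes "a \<in> B" shows "degree R (g a) = card (N a \<inter> M)"
proof -
  have "{e \<in> edges R. g a \<in> e} = (\<lambda>m. g ` N m) ` (N a \<inter> M)"
  proof (intro equalityI subsetI)
    fix e assume "e \<in> {e \<in> edges R. g a \<in> e}"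
    then obtain m where m: "m \<in> M" "e = g ` N m" "g a \<in> g ` N m" by (auto simp: R_def)
    then have "m \<in> N a" using g_mem[OF assms, of "N m"] N_M[OF m(1)] N_sym[of m a] by simp
    then show "e \<in> (\<lambda>m. g ` N m) ` (N a \<inter> M)" using m by blast
  next
    fix e assume "e \<in> (\<lambda>m. g ` N m) ` (N a \<inter> M)"
    then obtain m where "m \<in> N a" "m \<in> M" "e = g ` N m" by blast
    then show "e \<in> {e \<in> edges R. g a \<in> e}" using N_sym[of a m] by (simp add: R_def)
  qed
  moreover have "inj_on (\<lambda>m. g ` N m) (N a \<inter> M)"
    using inj_N N_M by (auto simp: inj_on_def g_image_eq)
  ultimately show ?thesis by (simp add: degree_def card_image)
qed

lemma R_leaves: "leaves R = g ` {a \<in> B. N a \<inter> L \<noteq> {}}"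
proof -
  have "degree R (g a) = 1 \<longleftrightarrow> N a \<inter> L \<noteq> {}" if "a \<in> B" for a
    using N_B_card[OF that] R_degree[OF that] by (auto simp: card_1_singleton_iff)
  then show ?thesis by (auto simp: leaves_def R_def)
qed

lemma R_edge:
  assumes "m \<in> M" "N m = {a, b}" shows "{g a, g b} \<in> edges R"
proof -
  have "g ` N m \<in> edges R" using assms(1) by (simp add: R_def)
  then show ?thesis using assms(2) by simp
qed

text \<open>A walk in \<open>C\<close> passes through vertices of \<open>M\<close> and
  \<open>L\<close>, which have no counterpart among the vertices of \<open>R\<close>. The invariant
  therefore speaks of all vertices of \<open>B\<close> equal or adjacent to the current one.\<close>

lemma R_reachable:
  assumes "a \<in> B" "(a, x) \<in> {(x, y). {x, y} \<in> edges C}\<^sup>*"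
  shows "\<forall>b\<in>B. b = x \<or> b \<in> N x \<longrightarrow> reachable R (g a) (g b)"
  using assms(2)
proof (induction rule: rtrancl_induct)
  case base
  then show ?case using N_B[OF assms(1)] disj by (auto simp: reachable_def)
next
  case (step x y)
  have xy: "y \<in> N x" "x \<in> N y" using step(2) by (auto simp: N_def insert_commute)
  show ?case
  proof (cases "y \<in> B")
    case True
    then show ?thesis using step.IH xy N_B[OF True] disj by blast
  next
    case False
    then have y: "y \<in> M \<or> y \<in> L" using N_verts[OF xy(1)] verts_C by blast
    then have xB: "x \<in> B" using N_M N_L xy by blast
    then have rx: "reachable R (g a) (g x)" using step.IH by blast
    have "reachable R (g a) (g b)" if b: "b \<in> B" "b \<in> N y" for b
    proof (cases "b = x")
      case False
      have "y \<in> M"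
        using y b(2) xy(2) False N_L[of y] by (auto simp: card_1_singleton_iff)
      then have "N y = {x, b}"
        using N_M[of y] b(2) xy(2) False by (auto simp: card_2_iff)
      then have "{g x, g b} \<in> edges R" using R_edge \<open>y \<in> M\<close> by blast
      then show ?thesis using rx unfolding reachable_def by (auto intro: rtrancl_into_rtrancl)
    qed (use rx in simp)
    then show ?thesis using False by blast
  qed
qed

lemma B_nonempty: "B \<noteq> {}"
proof -
  obtain x where "x \<in> verts C" using conn by (auto simp: connected_graph_def)
  then show ?thesis using N_M[of x] N_L[of x] verts_C by force
qed

lemma R_connected: "connected_graph R"
  unfolding connected_graph_def
proof (intro conjI ballI)
  show "verts R \<noteq> {}" using B_nonempty by (simp add: R_def)
  fix u v assume "u \<in> verts R" "v \<in> verts R"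
  then obtain a b where ab: "u = g a" "v = g b" "a \<in> B" "b \<in> B" by (auto simp: R_def)
  have "reachable C a b" using conn ab B_verts by (auto simp: connected_graph_def)
  then show "reachable R u v" using R_reachable[OF ab(3), of b] ab by (auto simp: reachable_def)
qed

text \<open>The successor map modulo \<open>n\<close> on a cycle, pulled back to \<open>B\<close>,
  is the permutation \<open>\<sigma>\<close> forbidden by \<open>no_cycle\<close>;
  \<open>\<mu>\<close> picks the vertex that subdivides each edge of the cycle.\<close>

lemma R_acyclic:
  assumes "n \<ge> 3" "subgraph H R" "isomorphic H (cycle_graph n)"
  shows False
proof -
  obtain f where f: "bij_betw f (verts H) {..<n}" "edges (cycle_graph n) = (\<lambda>e. f ` e) ` edges H"
    using assms(3) by (auto simp: isomorphic_def cycle_graph_def)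
  define A where "A = {a \<in> B. g a \<in> verts H}"
  define q where "q = f \<circ> g"
  have AB: "A \<subseteq> B" by (auto simp: A_def)
  have "verts H \<subseteq> g ` B" using assms(2) by (auto simp: subgraph_def R_def)
  then have gA: "g ` A = verts H" by (auto simp: A_def)
  have "bij_betw g A (verts H)"
    using gA AB B_verts g by (metis bij_betw_def inj_on_subset subset_trans)
  then have q: "bij_betw q A {..<n}" using f(1) unfolding q_def by (rule bij_betw_trans)
  define d where "d = inv_into A q"
  have d: "d i \<in> A" "q (d i) = i" if "i < n" for i
    using q that bij_betw_inv_into_right[OF q, of i] bij_betw_apply[OF bij_betw_inv_into[OF q], of i]
    by (auto simp: d_def)
  have dq: "d (q a) = a" if "a \<in> A" for a using bij_betw_inv_into_left[OF q that] by (simp add: d_def)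
  have qn: "q a < n" if "a \<in> A" for a using bij_betw_apply[OF q that] by simp
  have qinj: "a = b" if "q a = q b" "a \<in> A" "b \<in> A" for a b using dq that by metis
  define \<sigma> where "\<sigma> a = d (Suc (q a) mod n)" for a
  have n0: "Suc i mod n < n" for i using assms(1) by auto
  have \<sigma>: "\<sigma> a \<in> A" "q (\<sigma> a) = Suc (q a) mod n" if "a \<in> A" for a
    using d[OF n0] by (auto simp: \<sigma>_def)
  have ex: "\<exists>m\<in>M. N m = {a, \<sigma> a}" if a: "a \<in> A" for a
  proof -
    have "{q a, q (\<sigma> a)} \<in> edges (cycle_graph n)" using qn[OF a] \<sigma>[OF a] by (auto simp: cycle_graph_def)
    then obtain e where e: "e \<in> edges H" "f ` e = {q a, q (\<sigma> a)}" using f(2) by auto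
    then have "e \<in> edges R" "e \<subseteq> verts H" using assms(2) by (auto simp: subgraph_def finite_simple_graph_def)
    then obtain m where m: "m \<in> M" "e = g ` N m" by (auto simp: R_def)
    have sub: "N m \<subseteq> A" using m N_M[OF m(1)] \<open>e \<subseteq> verts H\<close> by (auto simp: A_def)
    have "q ` N m = q ` {a, \<sigma> a}" using e(2) m(2) by (simp add: q_def image_comp)
    then have "N m = {a, \<sigma> a}"
      using inj_on_image_eq_iff[of q A "N m" "{a, \<sigma> a}"] q sub a \<sigma> by (auto simp: bij_betw_def)
    then show ?thesis using m by blast
  qed
  then obtain \<mu> where \<mu>: "\<And>a. a \<in> A \<Longrightarrow> \<mu> a \<in> M \<and> N (\<mu> a) = {a, \<sigma> a}" by metis
  have cyc: "Suc i mod n = (if Suc i = n then 0 else Suc i)" if "i < n" for i using that by auto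
  have ne: "\<sigma> a \<noteq> a" if "a \<in> A" for a
  proof
    assume "\<sigma> a = a"
    then show False using \<sigma>(2)[OF that] cyc[OF qn[OF that]] assms(1) by (auto split: if_splits)
  qed
  have \<sigma>inj: "inj_on \<sigma> A"
  proof (rule inj_onI)
    fix a b assume ab: "a \<in> A" "b \<in> A" "\<sigma> a = \<sigma> b"
    then have "Suc (q a) mod n = Suc (q b) mod n" using \<sigma> by metis
    then have "q a = q b" using cyc[OF qn[OF ab(1)]] cyc[OF qn[OF ab(2)]] by (auto split: if_splits)
    then show "a = b" using qinj ab by blast
  qed
  have finA: "finite A" using finite_subset[OF AB] finite_subset[OF B_verts finite_verts] by blast
  have bij: "bij_betw \<sigma> A A"
    using \<sigma>inj endo_inj_surj[OF finA _ \<sigma>inj] \<sigma>(1) by (auto simp: bij_betw_def)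
  have \<mu>inj: "inj_on \<mu> A"
  proof (rule inj_onI, rule ccontr)
    fix a b assume ab: "a \<in> A" "b \<in> A" "\<mu> a = \<mu> b" "a \<noteq> b"
    \<comment> \<open>A shared subdividing vertex makes \<open>\<sigma>\<close> swap
      \<open>a\<close> and \<open>b\<close>, so each is the successor of the other modulo
      \<open>n\<close>, which is impossible for \<open>n \<ge> 3\<close>.\<close>
    then have "{a, \<sigma> a} = {b, \<sigma> b}" using \<mu> by metis
    then have "\<sigma> a = b" "\<sigma> b = a" using ab(4) by (auto simp: doubleton_eq_iff)
    then have "q b = Suc (q a) mod n" "q a = Suc (q b) mod n"
      using \<sigma>(2)[OF ab(1)] \<sigma>(2)[OF ab(2)] by simp_all
    then have "Suc (q a) = n \<and> q b = 0 \<or> q b = Suc (q a)" "Suc (q b) = n \<and> q a = 0 \<or> q a = Suc (q b)"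
      using cyc[OF qn[OF ab(1)]] cyc[OF qn[OF ab(2)]] by argo+
    then show False using assms(1) by arith
  qed
  have "d 0 \<in> A" using d(1) assms(1) by simp
  then have "A \<noteq> {}" by blast
  then show False by (rule no_cycle[OF _ AB bij ne \<mu>inj \<mu>])
qed

lemma R_one_three_tree: "one_three_tree R"
  unfolding one_three_tree_def tree_def
proof (intro conjI ballI)
  show "\<not> (\<exists>n\<ge>3. \<exists>H. subgraph H R \<and> isomorphic H (cycle_graph n))"
    using R_acyclic by blast
  fix v assume "v \<in> verts R"
  then obtain a where "a \<in> B" "v = g a" by (auto simp: R_def)
  then show "degree R v \<in> {1, 3}" using R_degree N_B_card by auto
qed (rule R_simple R_connected)+

text \<open>The last branch is meant for \<open>L\<close>, where \<open>N x\<close> is a singleton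
  and \<open>the_elem\<close> returns the vertex carrying the pendant edge.\<close>

definition \<phi> :: "'a \<Rightarrow> nat tvertex" where
  "\<phi> x = (if x \<in> B then Orig (g x) else if x \<in> M then Mid (g ` N x) else Pend (g (the_elem (N x))))"

lemma \<phi>_simps: "x \<in> B \<Longrightarrow> \<phi> x = Orig (g x)" "x \<in> M \<Longrightarrow> \<phi> x = Mid (g ` N x)"
  "x \<in> L \<Longrightarrow> N x = {a} \<Longrightarrow> \<phi> x = Pend (g a)"
  using disj by (auto simp: \<phi>_def)

lemma \<phi>_L: "x \<in> L \<Longrightarrow> \<exists>a\<in>B. N x = {a} \<and> \<phi> x = Pend (g a)"
  using N_L[of x] \<phi>_simps(3)[of x] by (auto simp: card_1_singleton_iff)

lemma \<phi>_bij: "bij_betw \<phi> (verts C) (verts (T_of R))"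
  unfolding bij_betw_def
proof
  show "inj_on \<phi> (verts C)"
  proof (rule inj_onI)
    fix x y assume xy: "x \<in> verts C" "y \<in> verts C" "\<phi> x = \<phi> y"
    consider "x \<in> B" | "x \<in> M" | "x \<in> L" using xy(1) verts_C by blast
    then show "x = y"
    proof cases
      case 1
      then have "y \<in> B" using xy \<phi>_simps \<phi>_L[of y] verts_C by (auto simp: \<phi>_def split: if_splits)
      then show ?thesis using xy 1 g_eq by (simp add: \<phi>_simps)
    next
      case 2
      then have "y \<in> M" using xy \<phi>_simps(2)[OF 2] \<phi>_L[of y] verts_C by (auto simp: \<phi>_def split: if_splits)
      then show ?thesis using xy 2 g_image_eq N_M inj_N by (auto simp: \<phi>_simps dest: inj_onD)
    next
      case 3
      then obtain a where a: "a \<in> B" "N x = {a}" "\<phi> x = Pend (g a)" using \<phi>_L by blast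
      then have "y \<in> L" using xy verts_C by (auto simp: \<phi>_def split: if_splits)
      then obtain b where b: "b \<in> B" "N y = {b}" "\<phi> y = Pend (g b)" using \<phi>_L by blast
      have "g a = g b" using a(3) b(3) xy(3) by simp
      then have "a = b" using a(1) b(1) g_eq B_verts by blast
      then show ?thesis using pendant_unique 3 \<open>y \<in> L\<close> a b by metis
    qed
  qed
  have "\<phi> ` B = Orig ` verts R" by (auto simp: R_def \<phi>_simps image_image)
  moreover have "\<phi> ` M = Mid ` edges R" by (auto simp: R_def \<phi>_simps image_image)
  moreover have "\<phi> ` L = Pend ` leaves R"
  proof
    show "\<phi> ` L \<subseteq> Pend ` leaves R"
    proof
      fix z assume "z \<in> \<phi> ` L"
      then obtain l a where "l \<in> L" "a \<in> B" "N l = {a}" "z = Pend (g a)" using \<phi>_L by force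
      then show "z \<in> Pend ` leaves R" unfolding R_leaves using N_sym[of l a] by blast
    qed
    show "Pend ` leaves R \<subseteq> \<phi> ` L"
    proof
      fix z assume "z \<in> Pend ` leaves R"
      then obtain a l where a: "a \<in> B" "l \<in> N a" "l \<in> L" "z = Pend (g a)" by (auto simp: R_leaves)
      then have "N l = {a}" using N_L[of l] N_sym[of a l] by (auto simp: card_1_singleton_iff)
      then show "z \<in> \<phi> ` L" using a \<phi>_simps(3) by force
    qed
  qed
  ultimately show "\<phi> ` verts C = verts (T_of R)" by (simp add: verts_C T_of_def image_Un)
qed

lemma \<phi>_edges: "edges (T_of R) = (\<lambda>e. \<phi> ` e) ` edges C"
proof
  show "edges (T_of R) \<subseteq> (\<lambda>e. \<phi> ` e) ` edges C"
  proof
    fix e assume "e \<in> edges (T_of R)"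
    then consider v e' where "e = {Orig v, Mid e'}" "e' \<in> edges R" "v \<in> e'"
      | v where "e = {Orig v, Pend v}" "v \<in> leaves R"
      by (auto simp: T_of_def)
    then show "e \<in> (\<lambda>e. \<phi> ` e) ` edges C"
    proof cases
      case 1
      then obtain m a where m: "m \<in> M" "e' = g ` N m" "a \<in> N m" "v = g a" by (auto simp: R_def)
      then have "a \<in> B" using N_M by blast
      then have "e = \<phi> ` {m, a}" using 1 m by (auto simp: \<phi>_simps)
      moreover have "{m, a} \<in> edges C" using m(3) by (simp add: N_def)
      ultimately show ?thesis by blast
    next
      case 2
      then obtain a l where a: "a \<in> B" "l \<in> N a" "l \<in> L" "v = g a" by (auto simp: R_leaves)
      then have "N l = {a}" using N_L[of l] N_sym[of a l] by (auto simp: card_1_singleton_iff)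
      then have "e = \<phi> ` {a, l}" using 2 a \<phi>_simps by auto
      moreover have "{a, l} \<in> edges C" using a(2) by (simp add: N_def)
      ultimately show ?thesis by blast
    qed
  qed
  show "(\<lambda>e. \<phi> ` e) ` edges C \<subseteq> edges (T_of R)"
  proof
    fix z assume "z \<in> (\<lambda>e. \<phi> ` e) ` edges C"
    then obtain e where e: "e \<in> edges C" "z = \<phi> ` e" by auto
    obtain x y where xy: "e = {x, y}" using edge_pair[OF simple e(1)] by blast
    \<comment> \<open>Every edge of \<open>C\<close> has an end in \<open>B\<close>, so it can be
      read from that end.\<close>
    have "\<phi> ` {x, y} \<in> edges (T_of R)" if "x \<in> B" "y \<in> N x" for x y
    proof (cases "y \<in> M")
      case True
      have "x \<in> N y" using that N_sym[of x y] by simp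
      then show ?thesis using True that by (auto simp: T_of_def \<phi>_simps R_def)
    next
      case False
      then have y: "y \<in> L" using N_B that by blast
      then have "N y = {x}" using N_L[of y] N_sym[of x y] that by (auto simp: card_1_singleton_iff)
      then have "\<phi> ` {x, y} = {Orig (g x), Pend (g x)}" using that y \<phi>_simps by simp
      moreover have "g x \<in> leaves R" using that y by (auto simp: R_leaves)
      ultimately show ?thesis by (auto simp: T_of_def)
    qed
    moreover have "y \<in> N x" "x \<in> N y" using e xy by (auto simp: N_def insert_commute)
    moreover have "x \<in> B \<or> y \<in> B" using N_M N_L N_verts[OF \<open>y \<in> N x\<close>] verts_C \<open>y \<in> N x\<close> by blast
    ultimately show "z \<in> edges (T_of R)" using e xy by (metis insert_commute)
  qed
qed

text \<open>Members of \<open>T3\<close> have natural numbers as vertices, so membership concerns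
  the copy of \<open>C\<close> under \<open>g\<close>, identified with \<open>T_of R\<close> by
  undoing \<open>g\<close> and applying \<open>\<phi>\<close>.\<close>

lemma relabelled_in_T3: "\<lparr>verts = g ` verts C, edges = (\<lambda>e. g ` e) ` edges C\<rparr> \<in> T3" (is "?H \<in> T3")
proof -
  let ?i = "inv_into (verts C) g"
  have sub: "e \<subseteq> verts C \<and> card e = 2" if "e \<in> edges C" for e
    using simple that by (auto simp: finite_simple_graph_def)
  have "card (g ` e) = 2" if "e \<in> edges C" for e
    using sub[OF that] g inj_on_subset by (metis card_image)
  then have "finite_simple_graph ?H"
    using finite_verts sub by (auto simp: finite_simple_graph_def)
  moreover have "isomorphic ?H (T_of R)"
    unfolding isomorphic_def
  proof (intro exI conjI)
    have "bij_betw g (verts C) (verts ?H)" using g by (simp add: bij_betw_def)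
    then show "bij_betw (\<phi> \<circ> ?i) (verts ?H) (verts (T_of R))"
      using \<phi>_bij by (blast intro: bij_betw_trans bij_betw_inv_into)
    have "(\<phi> \<circ> ?i) ` g ` e = \<phi> ` e" if "e \<in> edges C" for e
      using sub[OF that] inv_into_image_cancel[OF g, of e] by (metis image_comp)
    then show "edges (T_of R) = (\<lambda>e. (\<phi> \<circ> ?i) ` e) ` edges ?H"
      unfolding \<phi>_edges by (simp add: image_image cong: image_cong)
  qed
  ultimately show ?thesis using R_one_three_tree by (auto simp: T3_def)
qed

end

lemma isomorphic_T3: "\<exists>H\<in>T3. isomorphic C H"
proof -
  obtain g :: "'a \<Rightarrow> nat" where g: "inj_on g (verts C)"
    using finite_imp_inj_to_nat_seg[OF finite_verts] by auto
  have "isomorphic C \<lparr>verts = g ` verts C, edges = (\<lambda>e. g ` e) ` edges C\<rparr>"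
    unfolding isomorphic_def using g by (intro exI[of _ g]) (simp add: bij_betw_def)
  with relabelled_in_T3[OF g] show ?thesis by blast
qed

end

section \<open>Weightings of factors\<close>

text \<open>The counterpart of \<open>weighting\<close> for a graph as such, free of the locale, so
  that it can move between vertex types and between a graph and its components.\<close>

definition balanced :: "'a ugraph \<Rightarrow> ('a \<Rightarrow> 'a \<Rightarrow> nat) \<Rightarrow> bool" where
  "balanced G w \<longleftrightarrow> (\<forall>x y. w x y = w y x) \<and> (\<forall>x y. w x y > 0 \<longrightarrow> {x, y} \<in> edges G) \<and>
     (\<forall>x\<in>verts G. (\<Sum>y\<in>verts G. w x y) \<in> {2, 3})"

lemma balanced_isomorphic:
  assumes "finite_simple_graph C" "isomorphic C H" "balanced H w"
  shows "\<exists>w'. balanced C w'"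
proof -
  obtain f where f: "bij_betw f (verts C) (verts H)" "edges H = (\<lambda>e. f ` e) ` edges C"
    using assms(2) by (auto simp: isomorphic_def)
  define w' where "w' x y = (if x \<in> verts C \<and> y \<in> verts C then w (f x) (f y) else 0)" for x y
  have w: "w x y = w y x" "w x y > 0 \<Longrightarrow> {x, y} \<in> edges H" for x y
    using assms(3) by (auto simp: balanced_def)
  have "{x, y} \<in> edges C" if "w' x y > 0" for x y
  proof -
    have xy: "x \<in> verts C" "y \<in> verts C" "{f x, f y} \<in> edges H"
      using that w(2) by (auto simp: w'_def split: if_splits)
    then obtain e where e: "e \<in> edges C" "f ` e = f ` {x, y}" using f(2) by auto
    have "e \<subseteq> verts C" using assms(1) e(1) by (auto simp: finite_simple_graph_def)
    then have "e = {x, y}"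
      using inj_on_image_eq_iff[of f "verts C" e "{x, y}"] f(1) e(2) xy by (auto simp: bij_betw_def)
    then show ?thesis using e(1) by simp
  qed
  moreover have "(\<Sum>y\<in>verts C. w' x y) \<in> {2, 3}" if "x \<in> verts C" for x
  proof -
    have "(\<Sum>y\<in>verts C. w' x y) = (\<Sum>y\<in>verts C. w (f x) (f y))"
      by (rule sum.cong) (use that in \<open>auto simp: w'_def\<close>)
    also have "\<dots> = (\<Sum>z\<in>verts H. w (f x) z)" by (rule sum.reindex_bij_betw[OF f(1)])
    also have "\<dots> \<in> {2, 3}" using assms(3) bij_betw_apply[OF f(1) that] by (auto simp: balanced_def)
    finally show ?thesis .
  qed
  moreover have "w' x y = w' y x" for x y using w(1) by (simp add: w'_def)
  ultimately show ?thesis unfolding balanced_def by blast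
qed

lemma balanced_P2: "\<exists>w. balanced (path_graph 2) w"
proof
  show "balanced (path_graph 2) (\<lambda>x y. if {x, y} = {0, 1} then 2 else 0)"
    by (auto simp: balanced_def path_graph_def numeral_2_eq_2 lessThan_Suc doubleton_eq_iff less_Suc_eq)
qed

lemma cycle_graph_3:
  "verts (cycle_graph 3) = {0, 1, 2}" "edges (cycle_graph 3) = {{0, 1}, {1, 2}, {2, 0}}"
proof -
  have three: "{..<3} = {0, 1, 2 :: nat}" by auto
  then show "verts (cycle_graph 3) = {0, 1, 2}"
    by (simp add: cycle_graph_def)
  have "edges (cycle_graph 3) = (\<lambda>i. {i, Suc i mod 3}) ` {..<3}"
    by (auto simp: cycle_graph_def)
  then show "edges (cycle_graph 3) = {{0, 1}, {1, 2}, {2, 0}}"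
    unfolding three by (simp flip: numeral_2_eq_2)
qed

lemma balanced_C3: "\<exists>w. balanced (cycle_graph 3) w"
proof
  show "balanced (cycle_graph 3) (\<lambda>x y. if {x, y} \<in> {{0, 1}, {1, 2}, {2, 0}} then 1 else 0)"
    unfolding balanced_def cycle_graph_3 by (simp add: insert_commute)
qed

text \<open>The weights 2, 1, 1, 2 along the path are those of T_R for R a single edge.\<close>

lemma balanced_P5: "\<exists>w. balanced (path_graph 5) w"
proof
  have five: "{..<5} = {0, 1, 2, 3, 4 :: nat}" by auto
  have "edges (path_graph 5) = (\<lambda>i. {i, Suc i}) ` {..<4}"
    by (auto simp: path_graph_def)
  also have "{..<4} = {0, 1, 2, 3 :: nat}" by auto
  finally have edges: "edges (path_graph 5) = {{0, 1}, {1, 2}, {2, 3}, {3, 4}}" by (simp flip: numeral_2_eq_2)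
  have verts: "verts (path_graph 5) = {0, 1, 2, 3, 4}"
    by (simp add: path_graph_def five)
  show "balanced (path_graph 5) (\<lambda>x y. if {x, y} \<in> {{0, 1}, {3, 4}} then 2
      else if {x, y} \<in> {{1, 2}, {2, 3}} then 1 else 0)"
    unfolding balanced_def edges verts
  proof (intro conjI allI impI)
    fix x y :: nat
    show "(if {x, y} \<in> {{0, 1}, {3, 4}} then 2 else if {x, y} \<in> {{1, 2}, {2, 3}} then 1 else 0) =
      (if {y, x} \<in> {{0, 1}, {3, 4}} then 2 else if {y, x} \<in> {{1, 2}, {2, 3}} then 1 else (0::nat))"
      by (simp only: insert_commute[of x y])
  qed (auto split: if_splits simp: doubleton_eq_iff)
qed

lemma finite_edges: "finite_simple_graph G \<Longrightarrow> finite (edges G)"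
  by (rule finite_subset[of _ "Pow (verts G)"]) (auto simp: finite_simple_graph_def)

text \<open>An original vertex has sum 3, as 1 + 1 + 1 at degree 3 and as 1 + 2 at a leaf;
  subdividing vertices and pendant ends have sum 2.\<close>

lemma balanced_T_of:
  assumes R: "finite_simple_graph R" and deg: "\<And>v. v \<in> verts R \<Longrightarrow> degree R v \<in> {1, 3}"
  shows "\<exists>w. balanced (T_of R) w"
proof
  let ?T = "T_of R"
  define w :: "'a tvertex \<Rightarrow> 'a tvertex \<Rightarrow> nat" where
    "w x y = (if {x, y} \<in> edges ?T then if \<exists>v. Pend v \<in> {x, y} then 2 else 1 else 0)" for x y
  have "finite (leaves R)" using R by (auto simp: leaves_def finite_simple_graph_def)
  then have fin: "finite (verts ?T)"
    using R finite_edges[OF R] by (auto simp: T_of_def finite_simple_graph_def)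
  have e_Orig: "{Orig v, y} \<in> edges ?T \<longleftrightarrow>
      y \<in> Mid ` {e \<in> edges R. v \<in> e} \<or> y = Pend v \<and> v \<in> leaves R" for v y
    by (auto simp: T_of_def doubleton_eq_iff)
  have e_Mid: "{Mid e, y} \<in> edges ?T \<longleftrightarrow> e \<in> edges R \<and> y \<in> Orig ` e" for e y
    by (auto simp: T_of_def doubleton_eq_iff)
  have e_Pend: "{Pend v, y} \<in> edges ?T \<longleftrightarrow> v \<in> leaves R \<and> y = Orig v" for v y
    by (auto simp: T_of_def doubleton_eq_iff)
  have vT: "verts ?T = Orig ` verts R \<union> Mid ` edges R \<union> Pend ` leaves R" by (simp add: T_of_def)
  have sub: "e \<subseteq> verts R" "card e = 2" if "e \<in> edges R" for e
    using R that by (auto simp: finite_simple_graph_def)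
  have row: "(\<Sum>y\<in>verts ?T. w x y) = (\<Sum>y\<in>Y. w x y)"
    if "Y \<subseteq> verts ?T" "\<And>y. {x, y} \<in> edges ?T \<Longrightarrow> y \<in> Y" for x Y
    by (rule sum.mono_neutral_right[OF fin that(1)]) (use that in \<open>auto simp: w_def\<close>)
  have "(\<Sum>y\<in>verts ?T. w x y) \<in> {2, 3}" if x: "x \<in> verts ?T" for x
  proof (cases x)
    case (Orig v)
    then have v: "v \<in> verts R" using x by (auto simp: T_of_def)
    let ?M = "Mid ` {e \<in> edges R. v \<in> e}"
    have finM: "finite ?M" using finite_edges[OF R] by simp
    have "(\<Sum>y\<in>?M. w x y) = (\<Sum>y\<in>?M. 1)"
      by (rule sum.cong) (auto simp: w_def Orig e_Orig)
    also have "\<dots> = degree R v" by (simp add: degree_def card_image inj_on_def)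
    finally have M: "(\<Sum>y\<in>?M. w x y) = degree R v" .
    show ?thesis
    proof (cases "v \<in> leaves R")
      case True
      have "(\<Sum>y\<in>verts ?T. w x y) = (\<Sum>y\<in>insert (Pend v) ?M. w x y)"
        by (rule row) (use True in \<open>auto simp: Orig e_Orig vT\<close>)
      also have "\<dots> = w x (Pend v) + degree R v" using finM M by (subst sum.insert) auto
      also have "\<dots> = 3" using True by (auto simp: w_def Orig e_Orig leaves_def)
      finally show ?thesis by simp
    next
      case False
      have "(\<Sum>y\<in>verts ?T. w x y) = (\<Sum>y\<in>?M. w x y)"
        by (rule row) (use False in \<open>auto simp: Orig e_Orig vT\<close>)
      then show ?thesis using M False deg[OF v] v by (auto simp: leaves_def)
    qed
  next
    case (Mid e)
    then have e: "e \<in> edges R" using x by (auto simp: T_of_def)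
    have "(\<Sum>y\<in>verts ?T. w x y) = (\<Sum>y\<in>Orig ` e. w x y)"
      by (rule row) (use e sub in \<open>auto simp: Mid e_Mid vT\<close>)
    also have "\<dots> = (\<Sum>y\<in>Orig ` e. 1)"
      by (rule sum.cong) (use e in \<open>auto simp: w_def Mid e_Mid\<close>)
    also have "\<dots> = 2" using sub[OF e] by (simp add: card_image inj_on_def)
    finally show ?thesis by simp
  next
    case (Pend v)
    then have v: "v \<in> leaves R" using x by (auto simp: T_of_def)
    have "(\<Sum>y\<in>verts ?T. w x y) = (\<Sum>y\<in>{Orig v}. w x y)"
      by (rule row) (use v in \<open>auto simp: Pend e_Pend leaves_def vT\<close>)
    then show ?thesis using v by (auto simp: w_def Pend e_Pend)
  qed
  moreover have "w x y = w y x" for x y by (simp add: w_def insert_commute)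
  moreover have "w x y > 0 \<Longrightarrow> {x, y} \<in> edges ?T" for x y by (simp add: w_def split: if_splits)
  ultimately show "balanced ?T w" by (simp add: balanced_def)
qed

lemma balanced_T3:
  assumes "H \<in> T3" shows "\<exists>w. balanced H w"
proof -
  obtain R :: "nat ugraph" where H: "finite_simple_graph H" "isomorphic H (T_of R)" "one_three_tree R"
    using assms by (auto simp: T3_def)
  obtain w where "balanced (T_of R) w"
    using balanced_T_of[of R] H(3) by (auto simp: one_three_tree_def tree_def)
  then show ?thesis using balanced_isomorphic H by blast
qed

section \<open>Gluing weightings over the components of a factor\<close>

lemma reachable_refl: "reachable F v v"
  by (simp add: reachable_def)

lemma reachable_trans: "reachable F u v \<Longrightarrow> reachable F v w \<Longrightarrow> reachable F u w"
  unfolding reachable_def by (rule rtrancl_trans)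

lemma reachable_edge: "{u, v} \<in> edges F \<Longrightarrow> reachable F u v"
  unfolding reachable_def by auto

lemma reachable_sym:
  assumes "reachable F u v" shows "reachable F v u"
proof -
  have "sym {(x, y). {x, y} \<in> edges F}" by (auto simp: sym_def insert_commute)
  then show ?thesis using assms unfolding reachable_def by (meson sym_rtrancl symD)
qed

abbreviation component_of :: "'a ugraph \<Rightarrow> 'a \<Rightarrow> 'a ugraph" where
  "component_of F v \<equiv> induced F {u \<in> verts F. reachable F v u}"

lemma component_of_eq: "reachable F u v \<Longrightarrow> component_of F u = component_of F v"
  using reachable_trans reachable_sym by (metis (no_types, lifting))

lemma simple_induced: "finite_simple_graph F \<Longrightarrow> finite_simple_graph (induced F U)"
  by (auto simp: finite_simple_graph_def induced_def)

lemma balanced_factor: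
  fixes F G :: "'a ugraph"
  assumes "is_factor \<S> F G" and \<S>: "\<And>H. H \<in> \<S> \<Longrightarrow> \<exists>w. balanced H w"
  shows "\<exists>w. balanced G w"
proof -
  have F: "finite_simple_graph F" "verts F = verts G" "edges F \<subseteq> edges G"
    using assms(1) by (auto simp: is_factor_def spanning_subgraph_def subgraph_def)
  \<comment> \<open>The choice depends on the component as a graph, not on a vertex representing it,
    so the two ends of an edge use the same weighting and the glued one is symmetric.\<close>
  define W where "W C = (SOME w. balanced C w)" for C :: "'a ugraph"
  have "\<exists>w. balanced (component_of F v) w" if "v \<in> verts F" for v
  proof -
    have "component_of F v \<in> components F" using that by (auto simp: components_def)
    then obtain H where "H \<in> \<S>" "isomorphic (component_of F v) H"
      using assms(1) by (auto simp: is_factor_def)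
    then show ?thesis using balanced_isomorphic[OF simple_induced[OF F(1)]] \<S> by blast
  qed
  then have W: "balanced (component_of F v) (W (component_of F v))" if "v \<in> verts F" for v
    unfolding W_def by (rule someI_ex) (rule that)
  define w where "w x y = (if {x, y} \<in> edges F then W (component_of F x) x y else 0)" for x y
  have "w x y = w y x" for x y
  proof (cases "{x, y} \<in> edges F")
    case True
    have "component_of F x = component_of F y" by (rule component_of_eq[OF reachable_edge[OF True]])
    moreover have "W (component_of F x) x y = W (component_of F x) y x"
      using W[OF edge_ends(1)[OF F(1) True]] by (simp add: balanced_def)
    ultimately show ?thesis by (simp add: w_def insert_commute)
  qed (simp add: w_def insert_commute)
  moreover have "w x y > 0 \<Longrightarrow> {x, y} \<in> edges G" for x y
    using F(3) by (auto simp: w_def split: if_splits)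
  moreover have "(\<Sum>y\<in>verts G. w x y) \<in> {2, 3}" if x: "x \<in> verts G" for x
  proof -
    let ?C = "component_of F x"
    have b: "balanced ?C (W ?C)" using W x F(2) by simp
    have C: "verts ?C \<subseteq> verts G" "x \<in> verts ?C" using F(2) x by (auto simp: induced_def reachable_refl)
    have "(\<Sum>y\<in>verts G. w x y) = (\<Sum>y\<in>verts ?C. w x y)"
    proof (rule sum.mono_neutral_right[OF _ C(1)])
      show "finite (verts G)" using F by (simp add: finite_simple_graph_def)
      show "\<forall>y\<in>verts G - verts ?C. w x y = 0"
        using reachable_edge[of x _ F] F(2) by (auto simp: w_def induced_def)
    qed
    also have "\<dots> = (\<Sum>y\<in>verts ?C. W ?C x y)"
    proof (rule sum.cong[OF refl])
      fix y
      have "W ?C x y > 0 \<Longrightarrow> {x, y} \<in> edges ?C" using b by (simp add: balanced_def)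
      then show "w x y = W ?C x y" by (auto simp: w_def induced_def)
    qed
    also have "\<dots> \<in> {2, 3}" using b C(2) unfolding balanced_def by blast
    finally show ?thesis .
  qed
  ultimately show ?thesis unfolding balanced_def by blast
qed

section \<open>Isolated vertices and vertex expansion\<close>

lemma isolated_iff:
  assumes "finite_simple_graph G"
  shows "degree (del_verts G S) v = 0 \<longleftrightarrow> (\<forall>e\<in>edges G. v \<in> e \<longrightarrow> e \<inter> S \<noteq> {})"
proof -
  \<comment> \<open>An infinite set would also have \<open>card\<close> 0, so finiteness is what
    makes degree 0 mean isolated.\<close>
  have "finite {e \<in> edges (del_verts G S). v \<in> e}"
    using finite_edges[OF assms] by (simp add: del_verts_def)
  then show ?thesis by (auto simp: degree_def del_verts_def)
qed

text \<open>Each isolated vertex of \<open>del_verts G S\<close> has weight at least 2, all of it on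
  edges into \<open>S\<close>, and each vertex of \<open>S\<close> takes at most 3.\<close>

lemma balanced_imp_iso_bound:
  assumes G: "finite_simple_graph G" and w: "balanced G w" and S: "S \<subseteq> verts G"
  shows "2 * iso_number (del_verts G S) \<le> 3 * card S"
proof -
  define I where "I = {v \<in> verts G - S. degree (del_verts G S) v = 0}"
  have fin: "finite (verts G)" using G by (simp add: finite_simple_graph_def)
  have IV: "I \<subseteq> verts G" by (auto simp: I_def)
  have supp: "y \<in> S" if "x \<in> I" "w x y \<noteq> 0" for x y
  proof -
    have "{x, y} \<in> edges G" using w that by (simp add: balanced_def)
    then show ?thesis using that(1) by (auto simp: I_def isolated_iff[OF G])
  qed
  have "2 * card I = (\<Sum>x\<in>I. 2)" by simp
  also have "\<dots> \<le> (\<Sum>x\<in>I. \<Sum>y\<in>verts G. w x y)"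
    by (rule sum_mono) (use w IV in \<open>force simp: balanced_def\<close>)
  also have "\<dots> = (\<Sum>x\<in>I. \<Sum>y\<in>S. w x y)"
    by (intro sum.cong refl sum.mono_neutral_right[OF fin S]) (use supp in auto)
  also have "\<dots> = (\<Sum>y\<in>S. \<Sum>x\<in>I. w y x)"
    using w by (subst sum.swap) (simp add: balanced_def)
  also have "\<dots> \<le> (\<Sum>y\<in>S. \<Sum>x\<in>verts G. w y x)"
    by (intro sum_mono sum_mono2[OF fin IV]) auto
  also have "\<dots> \<le> (\<Sum>y\<in>S. 3)"
    by (rule sum_mono) (use w S in \<open>force simp: balanced_def\<close>)
  finally show ?thesis by (simp add: iso_number_def I_def del_verts_def)
qed

text \<open>The bound controls only independent sets, while \<open>X\<close> may contain edges. Its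
  vertices \<open>X0\<close> without neighbours in \<open>X\<close> become isolated once
  \<open>N X0\<close> is deleted. Every other vertex of \<open>X\<close> is itself a neighbour of
  \<open>X\<close> and lies outside \<open>N X0\<close>, so it pays for itself.\<close>

lemma iso_bound_imp_expansion:
  assumes G: "finite_simple_graph G"
    and iso: "\<And>S. S \<subseteq> verts G \<Longrightarrow> 2 * iso_number (del_verts G S) \<le> 3 * card S"
    and X: "X \<subseteq> verts G"
  shows "2 * card X \<le> 3 * card {y \<in> verts G. \<exists>x\<in>X. {x, y} \<in> edges G}"
proof -
  define X0 where "X0 = {x \<in> X. \<forall>y\<in>X. {x, y} \<notin> edges G}"
  define N where "N Z = {y \<in> verts G. \<exists>x\<in>Z. {x, y} \<in> edges G}" for Z
  have fin: "finite (verts G)" using G by (simp add: finite_simple_graph_def)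
  have finX: "finite X" and finN: "finite (N Z)" for Z
    using X fin finite_subset by (auto simp: N_def)
  have disj: "N X0 \<inter> X = {}" by (auto simp: N_def X0_def)
  have "X0 \<subseteq> {v \<in> verts (del_verts G (N X0)). degree (del_verts G (N X0)) v = 0}"
  proof
    fix x assume x: "x \<in> X0"
    have "e \<inter> N X0 \<noteq> {}" if "e \<in> edges G" "x \<in> e" for e
    proof -
      obtain u v where "e = {u, v}" using edge_pair[OF G \<open>e \<in> edges G\<close>] by blast
      then obtain y where "e = {x, y}" using \<open>x \<in> e\<close> by (auto simp: insert_commute)
      then show ?thesis using that edge_ends(2)[OF G] x by (auto simp: N_def)
    qed
    moreover have "x \<in> X" using x by (simp add: X0_def)
    ultimately show "x \<in> {v \<in> verts (del_verts G (N X0)). degree (del_verts G (N X0)) v = 0}"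
      using disj X by (auto simp: isolated_iff[OF G]) (auto simp: del_verts_def)
  qed
  then have "card X0 \<le> iso_number (del_verts G (N X0))"
    unfolding iso_number_def using fin by (intro card_mono) (auto simp: del_verts_def)
  then have 1: "2 * card X0 \<le> 3 * card (N X0)" using iso[of "N X0"] by (auto simp: N_def)
  have "X - X0 \<subseteq> N X - N X0"
  proof
    fix x assume x: "x \<in> X - X0"
    then obtain y where "y \<in> X" "{y, x} \<in> edges G" by (auto simp: X0_def insert_commute)
    then show "x \<in> N X - N X0" using x X disj by (auto simp: N_def)
  qed
  then have "card (X - X0) \<le> card (N X - N X0)" using finN by (intro card_mono) auto
  moreover have "card (N X - N X0) = card (N X) - card (N X0)" "card (N X0) \<le> card (N X)"
    using finN by (auto intro!: card_Diff_subset card_mono) (auto simp: N_def X0_def)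
  moreover have "card X = card X0 + card (X - X0)"
    using finX by (subst card_Un_disjoint[symmetric]) (auto simp: X0_def intro: arg_cong[where f = card])
  ultimately show ?thesis using 1 by (simp add: N_def)
qed

section \<open>Components of the support of an optimal weighting\<close>

lemma isomorphic_P2:
  assumes "verts C = {a, b}" "a \<noteq> b" "edges C = {{a, b}}"
  shows "isomorphic C (path_graph 2)"
proof -
  let ?f = "\<lambda>x. if x = a then 0 else 1 :: nat"
  have "{..<2} = {0, 1 :: nat}" by auto
  moreover have "edges (path_graph 2) = {{0, 1}}" by (auto simp: path_graph_def)
  ultimately show ?thesis
    unfolding isomorphic_def using assms
    by (intro exI[of _ ?f]) (auto simp: bij_betw_def inj_on_def path_graph_def)
qed

lemma isomorphic_C3:
  assumes "verts C = {a, b, c}" "a \<noteq> b" "b \<noteq> c" "c \<noteq> a" "edges C = {{a, b}, {b, c}, {c, a}}"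
  shows "isomorphic C (cycle_graph 3)"
proof -
  let ?f = "\<lambda>x. if x = a then 0 else if x = b then 1 else 2 :: nat"
  show ?thesis
    unfolding isomorphic_def cycle_graph_3 using assms
    by (intro exI[of _ ?f]) (auto simp: bij_betw_def inj_on_def)
qed

context optimal_weighting
begin

definition support :: "'a ugraph" where
  "support = \<lparr>verts = V, edges = {{x, y} |x y. f x y > 0}\<rparr>"

lemma support_edge: "{x, y} \<in> edges support \<longleftrightarrow> y \<in> nbrs x"
  using f_comm[of x y] by (auto simp: support_def nbrs_def doubleton_eq_iff)

lemma support_simple: "finite_simple_graph support"
proof -
  have "e \<subseteq> V \<and> card e = 2" if e: "e \<in> edges support" for e
  proof -
    obtain x y where "e = {x, y}" "f x y > 0" using e by (auto simp: support_def)
    then show ?thesis using f_in[of x y] by auto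
  qed
  then show ?thesis using finite_V by (auto simp: finite_simple_graph_def support_def)
qed

context
  fixes v :: 'a
  assumes v: "v \<in> V"
begin

definition comp :: "'a ugraph" where
  "comp = component_of support v"

lemma comp_verts: "verts comp = {u \<in> V. reachable support v u}"
  by (auto simp: comp_def induced_def support_def)

lemma v_comp: "v \<in> verts comp"
  using v by (simp add: comp_verts reachable_refl)

lemma comp_V: "x \<in> verts comp \<Longrightarrow> x \<in> V"
  by (simp add: comp_verts)

lemma comp_closed: "x \<in> verts comp \<Longrightarrow> y \<in> nbrs x \<Longrightarrow> y \<in> verts comp"
  using nbrs_V[of x] reachable_trans[OF _ reachable_edge, of support v x y] support_edge[of x y]
  by (auto simp: comp_verts)

lemma comp_edge: "{x, y} \<in> edges comp \<longleftrightarrow> x \<in> verts comp \<and> y \<in> nbrs x"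
proof -
  have "{x, y} \<in> edges comp \<longleftrightarrow> y \<in> nbrs x \<and> x \<in> verts comp \<and> y \<in> verts comp"
    using support_edge[of x y] by (auto simp: comp_def induced_def support_def)
  then show ?thesis using comp_closed[of x y] by blast
qed

lemma comp_simple: "finite_simple_graph comp"
  unfolding comp_def by (rule simple_induced[OF support_simple])

text \<open>Walks in \<open>support\<close> that start at \<open>v\<close> never leave the
  component, so they are walks in \<open>comp\<close> too.\<close>

lemma comp_connected: "connected_graph comp"
proof -
  have reach: "reachable comp v u" if "(v, u) \<in> {(x, y). {x, y} \<in> edges support}\<^sup>*" for u
    using that
  proof (induction rule: rtrancl_induct)
    case (step x y)
    have y: "y \<in> nbrs x" using step(2) support_edge by simp
    then have "x \<in> V" using nbrs_sym[of y x] nbrs_V by blast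
    then have "x \<in> verts comp" using step(1) by (simp add: comp_verts reachable_def)
    then have "reachable comp x y" using y comp_edge reachable_edge by metis
    then show ?case using step.IH reachable_trans by metis
  qed (rule reachable_refl)
  have "reachable comp a b" if "a \<in> verts comp" "b \<in> verts comp" for a b
  proof -
    have "reachable comp v a" "reachable comp v b"
      using reach that by (auto simp: comp_verts reachable_def)
    then show ?thesis using reachable_sym reachable_trans by metis
  qed
  then show ?thesis using v_comp by (auto simp: connected_graph_def)
qed

text \<open>Pins down small components: it is enough to exhibit a set closed under neighbours that
  meets the component.\<close>

lemma comp_subset:
  assumes "w \<in> verts comp" "w \<in> W" "\<And>x. x \<in> W \<Longrightarrow> nbrs x \<subseteq> W"
  shows "verts comp \<subseteq> W"
proof
  fix u assume u: "u \<in> verts comp"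
  have "reachable support w u"
    using u assms(1) reachable_trans[OF reachable_sym, of support v w u] by (simp add: comp_verts)
  then have "(w, u) \<in> {(x, y). {x, y} \<in> edges support}\<^sup>*" by (simp add: reachable_def)
  then show "u \<in> W"
    by (induction rule: rtrancl_induct) (use assms(2,3) support_edge in auto)
qed

lemma comp_edges_of:
  assumes "\<And>x y. x \<in> verts comp \<Longrightarrow> y \<in> nbrs x \<Longrightarrow> {x, y} \<in> E"
    and "\<And>e. e \<in> E \<Longrightarrow> \<exists>x y. e = {x, y} \<and> x \<in> verts comp \<and> y \<in> nbrs x"
  shows "edges comp = E"
proof (intro equalityI subsetI)
  fix e assume e: "e \<in> edges comp"
  then obtain x y where "e = {x, y}" using edge_pair[OF comp_simple] by metis
  then show "e \<in> E" using e assms(1) comp_edge by simp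
next
  fix e assume "e \<in> E"
  then obtain x y where "e = {x, y}" "x \<in> verts comp" "y \<in> nbrs x" using assms(2) by blast
  then show "e \<in> edges comp" using comp_edge by simp
qed

text \<open>The edge of weight 2 at \<open>l\<close> uses up the whole sum of \<open>y\<close>, so
  neither end has a further neighbour.\<close>

lemma comp_P2:
  assumes "l \<in> verts comp" "tip l" "y \<in> nbrs l" "row f y = 2"
  shows "isomorphic comp (path_graph 2)"
proof (rule isomorphic_P2)
  have l: "nbrs l = {y}" "f l y = 2" using tip_nbrs[OF assms(2)] assms(3) by auto
  have y: "nbrs y = {l}"
    by (rule rest_empty) (use l assms(4) f_comm[of y l] in \<open>auto simp: nbrs_def\<close>)
  show "l \<noteq> y" using f_in[of l y] l by simp
  have "verts comp \<subseteq> {l, y}" by (rule comp_subset[OF assms(1)]) (use l y in auto)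
  then show verts: "verts comp = {l, y}" using assms(1) comp_closed[OF assms(1,3)] by blast
  show "edges comp = {{l, y}}"
    by (rule comp_edges_of) (use verts l y in auto)
qed

lemma comp_C3:
  assumes "m \<in> verts comp" "mid m" "mid m'" "m' \<in> nbrs m"
  shows "isomorphic comp (cycle_graph 3)"
proof -
  obtain a where a: "m \<noteq> m'" "a \<noteq> m" "a \<noteq> m'" "nbrs m = {m', a}" "nbrs m' = {m, a}" "nbrs a = {m, m'}"
    using mid_mid_component assms by blast
  have "verts comp \<subseteq> {m, m', a}" by (rule comp_subset[OF assms(1)]) (use a in auto)
  moreover have "a \<in> verts comp" "m' \<in> verts comp" using comp_closed[OF assms(1)] a(4) by auto
  ultimately have verts: "verts comp = {m, m', a}" using assms(1) by blast
  have "edges comp = {{m, m'}, {m', a}, {a, m}}"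
  proof (rule comp_edges_of)
    show "{x, y} \<in> {{m, m'}, {m', a}, {a, m}}" if "x \<in> verts comp" "y \<in> nbrs x" for x y
      using that verts a(4-6) by (auto simp: insert_commute)
    show "\<exists>x y. e = {x, y} \<and> x \<in> verts comp \<and> y \<in> nbrs x" if "e \<in> {{m, m'}, {m', a}, {a, m}}" for e
    proof -
      have "m' \<in> nbrs m" "a \<in> nbrs m'" "m \<in> nbrs a" using a(4-6) by auto
      moreover have "m \<in> verts comp" "m' \<in> verts comp" "a \<in> verts comp" using verts by auto
      ultimately show ?thesis using that by blast
    qed
  qed
  then show ?thesis using isomorphic_C3[OF verts] a(1-3) by simp
qed

text \<open>Under the two exclusions every neighbour of a \<open>tip\<close> or a \<open>mid\<close>
  is \<open>big\<close>, so the three kinds of vertices form a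
  \<open>subdivided_tree\<close>.\<close>

lemma comp_T3:
  assumes tips: "\<And>l y. l \<in> verts comp \<Longrightarrow> tip l \<Longrightarrow> y \<in> nbrs l \<Longrightarrow> row f y \<noteq> 2"
    and mids: "\<And>m m'. m \<in> verts comp \<Longrightarrow> mid m \<Longrightarrow> m' \<in> nbrs m \<Longrightarrow> \<not> mid m'"
  shows "\<exists>H\<in>T3. isomorphic comp H"
proof -
  define B M L where "B = {x \<in> verts comp. big x}" and "M = {x \<in> verts comp. mid x}"
    and "L = {x \<in> verts comp. tip x}"
  define N where "N x = {y. {x, y} \<in> edges comp}" for x
  have N: "N x = nbrs x" if "x \<in> verts comp" for x using that comp_edge by (simp add: N_def)
  have nbr: "y \<in> verts comp \<and> (big y \<or> mid y \<or> tip y)" if "x \<in> verts comp" "y \<in> nbrs x" for x y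
    using comp_closed[OF that] comp_V trichotomy by blast
  have not2: "big y" if "row f y \<noteq> 2" "y \<in> V" for y using row23 that by (auto simp: big_def)
  have mid_big: "big y" if "m \<in> verts comp" "mid m" "y \<in> nbrs m" for m y
    using nbr[OF that(1,3)] mids[OF that] mid_nbr_not_tip[OF that(2,3)] by blast
  interpret subdivided_tree comp B M L N
  proof
    show "finite_simple_graph comp" by (rule comp_simple)
    show "connected_graph comp" by (rule comp_connected)
    show "N x = {y. {x, y} \<in> edges comp}" for x by (simp add: N_def)
    show "verts comp = B \<union> M \<union> L"
      using trichotomy comp_V by (auto simp: B_def M_def L_def)
    show "B \<inter> M = {}" "B \<inter> L = {}" "M \<inter> L = {}"
      using exclusive by (auto simp: B_def M_def L_def)
    show "N x \<subseteq> B \<and> card (N x) = 2" if "x \<in> M" for x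
    proof -
      have x: "x \<in> verts comp" "mid x" using that by (auto simp: M_def)
      have "nbrs x \<subseteq> B" using mid_big[OF x] nbr[OF x(1)] by (auto simp: B_def)
      then show ?thesis using N[OF x(1)] mid_nbrs[OF x(2)] by simp
    qed
    show "N x \<subseteq> B \<and> card (N x) = 1" if "x \<in> L" for x
    proof -
      have x: "x \<in> verts comp" "tip x" using that by (auto simp: L_def)
      have "big y \<and> y \<in> verts comp" if "y \<in> nbrs x" for y
        using tips[OF x that] nbr[OF x(1) that] not2 comp_V by blast
      then have "nbrs x \<subseteq> B" by (auto simp: B_def)
      then show ?thesis using N[OF x(1)] tip_nbrs[OF x(2)] by auto
    qed
    fix x assume "x \<in> B"
    then have x: "x \<in> verts comp" "big x" by (auto simp: B_def)
    show "N x \<subseteq> M \<union> L"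
      using N[OF x(1)] nbr[OF x(1)] big_nbrs_light[OF x(2)] by (auto simp: M_def L_def)
    have "N x \<inter> M = nbrs x \<inter> {y. mid y}" "N x \<inter> L = nbrs x \<inter> {y. tip y}"
      using N[OF x(1)] nbr[OF x(1)] by (auto simp: M_def L_def)
    then show "card (N x \<inter> M) = 3 \<and> N x \<inter> L = {} \<or> card (N x \<inter> M) = 1 \<and> card (N x \<inter> L) = 1"
      using big_nbrs[OF x(2)] by simp
  next
    show "inj_on N M"
    proof (rule inj_onI)
      fix m m' assume m: "m \<in> M" "m' \<in> M" "N m = N m'"
      then have "m \<in> verts comp" "mid m" "m' \<in> verts comp" "mid m'" by (auto simp: M_def)
      then show "m = m'" using mid_determined[of m m'] mid_big[of m] N m(3) by simp
    qed
  next
    fix A \<sigma> \<mu>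
    assume A: "A \<noteq> {}" "A \<subseteq> B" "bij_betw \<sigma> A A" "\<And>a. a \<in> A \<Longrightarrow> \<sigma> a \<noteq> a" "inj_on \<mu> A"
      "\<And>a. a \<in> A \<Longrightarrow> \<mu> a \<in> M \<and> N (\<mu> a) = {a, \<sigma> a}"
    have "big a" "mid (\<mu> a)" "nbrs (\<mu> a) = {a, \<sigma> a}" if "a \<in> A" for a
      using A(2) A(6)[OF that] that N[of "\<mu> a"] by (auto simp: B_def M_def)
    then show False using no_alternating_cycle[of A \<sigma> \<mu>] A by blast
  qed
  show ?thesis by (rule isomorphic_T3)
qed

text \<open>A component that is a P_5 appears here as the member of \<open>T3\<close> for which R is
  a single edge: 2 vertices of weight 3, joined through one \<open>mid\<close>, with a
  \<open>tip\<close> at each.\<close>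

lemma comp_in_family: "\<exists>H\<in>{path_graph 2, cycle_graph 3, path_graph 5} \<union> T3. isomorphic comp H"
proof (cases "\<exists>l y. l \<in> verts comp \<and> tip l \<and> y \<in> nbrs l \<and> row f y = 2")
  case True
  then show ?thesis using comp_P2 by blast
next
  case no_P2: False
  show ?thesis
  proof (cases "\<exists>m m'. m \<in> verts comp \<and> mid m \<and> m' \<in> nbrs m \<and> mid m'")
    case True
    then show ?thesis using comp_C3 by blast
  next
    case False
    then have "\<exists>H\<in>T3. isomorphic comp H" using no_P2 comp_T3 by blast
    then show ?thesis by blast
  qed
qed

end

lemma support_factor:
  assumes "finite_simple_graph G" "verts G = V" "\<And>x y. adj x y \<longleftrightarrow> {x, y} \<in> edges G"
  shows "is_factor ({path_graph 2, cycle_graph 3, path_graph 5} \<union> T3) support G"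
  unfolding is_factor_def spanning_subgraph_def subgraph_def
proof (intro conjI ballI)
  show "finite_simple_graph support" by (rule support_simple)
  show "verts support = verts G" "verts support \<subseteq> verts G"
    using assms by (simp_all add: support_def)
  show "edges support \<subseteq> edges G"
    using f_adj assms(3) by (auto simp: support_def)
  fix C assume "C \<in> components support"
  then obtain v where "v \<in> V" "C = component_of support v"
    by (auto simp: components_def support_def)
  then show "\<exists>H\<in>{path_graph 2, cycle_graph 3, path_graph 5} \<union> T3. isomorphic C H"
    using comp_in_family[of v] by (simp add: comp_def)
qed

end

theorem theorem6:
  fixes G :: "'a ugraph"
  assumes "finite_simple_graph G"
  shows "(\<exists>F. is_factor ({path_graph 2, cycle_graph 3, path_graph 5} \<union> T3) F G) \<longleftrightarrow>
    (\<forall>S \<subseteq> verts G. real (iso_number (del_verts G S)) \<le> 3 / 2 * real (card S))"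
proof -
  have nat_bound: "real i \<le> 3 / 2 * real k \<longleftrightarrow> 2 * i \<le> 3 * k" for i k :: nat
    by linarith
  show ?thesis
    unfolding nat_bound
  proof (intro iffI allI impI)
    fix S assume F: "\<exists>F. is_factor ({path_graph 2, cycle_graph 3, path_graph 5} \<union> T3) F G"
      and S: "S \<subseteq> verts G"
    have "\<exists>w. balanced H w" if "H \<in> {path_graph 2, cycle_graph 3, path_graph 5} \<union> T3" for H
      using that balanced_P2 balanced_C3 balanced_P5 balanced_T3 by auto
    then obtain w where "balanced G w" using balanced_factor F by metis
    then show "2 * iso_number (del_verts G S) \<le> 3 * card S"
      using balanced_imp_iso_bound assms S by blast
  next
    assume iso: "\<forall>S\<subseteq>verts G. 2 * iso_number (del_verts G S) \<le> 3 * card S"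
    interpret adjacency "verts G" "\<lambda>x y. {x, y} \<in> edges G"
      using assms edge_ends[OF assms] by unfold_locales (auto simp: finite_simple_graph_def insert_commute)
    have "2 * card X \<le> 3 * card {y \<in> verts G. \<exists>x\<in>X. {x, y} \<in> edges G}" if "X \<subseteq> verts G" for X
      using iso_bound_imp_expansion[OF assms _ that] iso by blast
    then obtain g where "weighting g" using weighting_exists by blast
    then obtain f where "optimal_weighting (verts G) (\<lambda>x y. {x, y} \<in> edges G) f"
      using optimal_weighting_exists by blast
    then interpret optimal_weighting "verts G" "\<lambda>x y. {x, y} \<in> edges G" f .
    show "\<exists>F. is_factor ({path_graph 2, cycle_graph 3, path_graph 5} \<union> T3) F G"
      using support_factor[OF assms] by blast
  qed
qed

end
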